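(* Let $r,n\ge 1$. If $\chi_\lambda$ is the irreducible character of $G(r,1,n)$ indexed by the $r$-tuple $\lambda$ of partitions $\lambda(0),\ldots,\lambda(r-1)$ (whose sizes add up to $n$), then the Poincaré polynomial $$R_\lambda^*(t)=\frac{1}{\chi_\lambda(1)}\sum_{w\in G(r,1,n)}\chi_\lambda(w)\,t^{\dim(V^w)}$$ factors as $$R_{\lambda}^*(t)=\prod_{ij\in\lambda(0)}(t+r-1+rc_{ij})\prod_{ij\in\lambda(1)}(t-1+rc_{ij})\cdots\prod_{ij\in\lambda(r-1)}(t-1+rc_{ij}),$$ where $ij\in\lambda(k)$ ranges over the boxes of the Young diagram of $\lambda(k)$ and $c_{ij}=j-i$ is the content of the box in row $i$ and column $j$.
   Context: The group $G(r,1,n)$ is the group of all $n\times n$ monomial matrices whose nonzero entries are complex $r$-th roots of unity; it acts on $V=\mathbb{C}^n$ by this standard monomial representation. For $w\in G(r,1,n)$, $V^w=\{v\in V\mid wv=v\}$ is the fixed point space. Each element $g\in G(r,1,n)$ is conjugate by a permutation matrix to a direct sum of blocks $\delta_i\sigma_i$ with $\delta_i$ diagonal and $\sigma_i$ a cyclic permutation matrix; the cycle-size of the block is the order of $\sigma_i$ and its cycle-product is $\det(\delta_i)$. Indexing of characters: let $C_r$ be the cyclic group generated by $\zeta_r=e^{2\pi i/r}$, with irreducible characters $\gamma_0,\dots,\gamma_{r-1}$, $\gamma_k(\zeta_r)=\zeta_r^k$. Let $p_{d,c}$ ($d\ge1$, $c\in C_r$) be algebraically independent indeterminates over $\mathbb{C}$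 and put $p_{d,k}=\frac1r\sum_{c\in C_r}\gamma_k(c)p_{d,c}$. For a partition $\mu$ of $m$, let $\chi_\mu$ be the irreducible character of the symmetric group $S_m$ indexed by $\mu$ (with a single row indexing the trivial character), and let $s_{\mu,k}$ be the Schur function $s_\mu=\frac{1}{m!}\sum_{\sigma\in S_m}\chi_\mu(\sigma)p_\sigma$ expressed in the power sums $p_{d,k}$, where $p_\sigma$ is the product over cycles of $\sigma$ of the power sum of degree equal to the cycle length. For $g\in G(r,1,n)$ let $P_g$ be the product over the blocks of $g$ of $p_{d,c}$, where $d$ is the cycle-size and $c$ the cycle-product. The irreducible characters $\chi_\lambda$ of $G=G(r,1,n)$ are indexed by $r$-tuples $\lambda=(\lambda(0),\dots,\lambda(r-1))$ of partitions of total size $n$ so that $$\prod_{k=0}^{r-1}s_{\lambda(k),k}=\frac{1}{|G|}\sum_{g\in G}\chi_\lambda(g)P_g.$$ Equivalently, with $n_k=|\lambda(k)|$, $\chi_\lambda$ is induced from the block subgroup $\prod_k G(r,1,n_k)$ of the outer product over $k$ of the characters $g\mapsto\chi_{\lambda(k)}(\bar g)\,\gamma_k(\pi(g))$, where $\bar g\in S_{n_k}$ is the underlying permutation and $\pi(g)$ the product of the nonzero entries of $g$. *)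

theory Defs
  imports
    "HOL-Library.Poly_Mapping"
    "HOL-Library.Function_Algebras"
    "HOL-Combinatorics.Orbits"
    "HOL-Computational_Algebra.Polynomial"
    "Jordan_Normal_Form.VS_Connect"
begin

definition grn :: "nat \<Rightarrow> nat \<Rightarrow> complex mat set" where
  "grn r n = {A \<in> carrier_mat n n.
     (\<forall>i<n. \<exists>!j. j < n \<and> A $$ (i,j) \<noteq> 0) \<and>
     (\<forall>j<n. \<exists>!i. i < n \<and> A $$ (i,j) \<noteq> 0) \<and>
     (\<forall>i<n. \<forall>j<n. A $$ (i,j) \<noteq> 0 \<longrightarrow> A $$ (i,j) ^ r = 1)}"

definition fixed_space :: "nat \<Rightarrow> complex mat \<Rightarrow> complex vec set" where
  "fixed_space n w = {v \<in> carrier_vec n. w *\<^sub>v v = v}"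

definition fixed_dim :: "nat \<Rightarrow> complex mat \<Rightarrow> nat" where
  "fixed_dim n w =
     vectorspace.dim class_ring ((module_vec TYPE(complex) n)\<lparr>carrier := fixed_space n w\<rparr>)"

definition irreducible_representation ::
    "nat \<Rightarrow> complex mat set \<Rightarrow> nat \<Rightarrow> (complex mat \<Rightarrow> complex mat) \<Rightarrow> bool" where
  "irreducible_representation n G d \<rho> \<longleftrightarrow>
     d > 0 \<and>
     (\<forall>g\<in>G. \<rho> g \<in> carrier_mat d d) \<and>
     \<rho> (1\<^sub>m n) = 1\<^sub>m d \<and>
     (\<forall>g\<in>G. \<forall>h\<in>G. \<rho> (g * h) = \<rho> g * \<rho> h) \<and>
     (\<forall>W. VectorSpace.subspace class_ring W (module_vec TYPE(complex) d) \<longrightarrow>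
          (\<forall>g\<in>G. \<forall>v\<in>W. \<rho> g *\<^sub>v v \<in> W) \<longrightarrow>
          W = {0\<^sub>v d} \<or> W = carrier_vec d)"

text \<open>Only the values of \<open>\<chi>\<close> on the group \<open>G\<close> of \<open>n \<times> n\<close> matrices matter.\<close>

definition irreducible_character :: "nat \<Rightarrow> complex mat set \<Rightarrow> (complex mat \<Rightarrow> complex) \<Rightarrow> bool" where
  "irreducible_character n G \<chi> \<longleftrightarrow>
     (\<exists>d \<rho>. irreducible_representation n G d \<rho> \<and> (\<forall>g\<in>G. \<chi> g = (\<Sum>i<d. \<rho> g $$ (i,i))))"

definition is_partition :: "nat list \<Rightarrow> bool" where
  "is_partition \<mu> \<longleftrightarrow> sorted_wrt (\<ge>) \<mu> \<and> 0 \<notin> set \<mu>"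

text \<open>Rows and columns are counted from 0, which does not affect contents.\<close>

definition diagram :: "nat list \<Rightarrow> (nat \<times> nat) set" where
  "diagram \<mu> = {(i,j). i < length \<mu> \<and> j < \<mu> ! i}"

definition box_content :: "nat \<times> nat \<Rightarrow> int" where
  "box_content b = int (snd b) - int (fst b)"

text \<open>The symmetric group \<open>S\<^sub>m\<close> acts on \<open>{0,\<dots>,m-1}\<close>. Elements of the group algebra
  \<open>\<complex>[S\<^sub>m]\<close> are functions vanishing outside \<open>S\<^sub>m\<close>. The irreducible character indexed by
  \<open>\<mu>\<close> is the character of the Specht module in the form \<open>\<complex>[S\<^sub>m] c\<close>, where \<open>c = ab\<close> is the
  Young symmetrizer, \<open>a\<close> being the sum over the row stabilizer and \<open>b\<close> the signed sum over the
  column stabilizer of a tableau of shape \<open>\<mu>\<close>. For a single row, \<open>c\<close> is the sum of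
  all group elements and the module is trivial. The tableau used is the one filled row by row with
  \<open>0,1,2,\<dots>\<close>; the character does not depend on this choice.\<close>

definition symgrp :: "nat \<Rightarrow> (nat \<Rightarrow> nat) set" where
  "symgrp m = {\<sigma>. \<sigma> permutes {..<m}}"

definition tab_entry :: "nat list \<Rightarrow> nat \<times> nat \<Rightarrow> nat" where
  "tab_entry \<mu> b = sum_list (take (fst b) \<mu>) + snd b"

definition tab_row :: "nat list \<Rightarrow> nat \<Rightarrow> nat set" where
  "tab_row \<mu> i = {tab_entry \<mu> (i,j) | j. (i,j) \<in> diagram \<mu>}"

definition tab_col :: "nat list \<Rightarrow> nat \<Rightarrow> nat set" where
  "tab_col \<mu> j = {tab_entry \<mu> (i,j) | i. (i,j) \<in> diagram \<mu>}"

definition row_stabilizer :: "nat list \<Rightarrow> (nat \<Rightarrow> nat) set" where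
  "row_stabilizer \<mu> = {\<sigma> \<in> symgrp (sum_list \<mu>). \<forall>i. \<sigma> ` tab_row \<mu> i = tab_row \<mu> i}"

definition col_stabilizer :: "nat list \<Rightarrow> (nat \<Rightarrow> nat) set" where
  "col_stabilizer \<mu> = {\<sigma> \<in> symgrp (sum_list \<mu>). \<forall>j. \<sigma> ` tab_col \<mu> j = tab_col \<mu> j}"

type_synonym grpalg = "(nat \<Rightarrow> nat) \<Rightarrow> complex"

definition group_algebra :: "nat \<Rightarrow> grpalg set" where
  "group_algebra m = {f. \<forall>\<tau>. \<tau> \<notin> symgrp m \<longrightarrow> f \<tau> = 0}"

definition conv :: "nat \<Rightarrow> grpalg \<Rightarrow> grpalg \<Rightarrow> grpalg" where
  "conv m f g = (\<lambda>\<tau>. \<Sum>\<sigma>\<in>symgrp m. f \<sigma> * g (inv_into UNIV \<sigma> \<circ> \<tau>))"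

definition row_symmetrizer :: "nat list \<Rightarrow> grpalg" where
  "row_symmetrizer \<mu> = (\<lambda>\<tau>. if \<tau> \<in> row_stabilizer \<mu> then 1 else 0)"

definition col_antisymmetrizer :: "nat list \<Rightarrow> grpalg" where
  "col_antisymmetrizer \<mu> = (\<lambda>\<tau>. if \<tau> \<in> col_stabilizer \<mu> then of_int (Permutations.sign \<tau>) else 0)"

definition young_symmetrizer :: "nat list \<Rightarrow> grpalg" where
  "young_symmetrizer \<mu> = conv (sum_list \<mu>) (row_symmetrizer \<mu>) (col_antisymmetrizer \<mu>)"

definition specht_module :: "nat list \<Rightarrow> grpalg set" where
  "specht_module \<mu> =
     (\<lambda>f. conv (sum_list \<mu>) f (young_symmetrizer \<mu>)) ` group_algebra (sum_list \<mu>)"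

definition left_translate :: "(nat \<Rightarrow> nat) \<Rightarrow> grpalg \<Rightarrow> grpalg" where
  "left_translate \<sigma> f = (\<lambda>\<tau>. f (inv_into UNIV \<sigma> \<circ> \<tau>))"

definition fscale :: "complex \<Rightarrow> ('a \<Rightarrow> complex) \<Rightarrow> 'a \<Rightarrow> complex" where
  "fscale c f = (\<lambda>x. c * f x)"

interpretation fun_vs: vector_space fscale
  by unfold_locales (auto simp: fscale_def plus_fun_def algebra_simps fun_eq_iff)

text \<open>The trace of a linear endomorphism \<open>\<phi>\<close> of a finite-dimensional space \<open>W\<close> of functions, as
  the trace of its matrix in some basis.\<close>

definition trace_on :: "('a \<Rightarrow> complex) set \<Rightarrow> (('a \<Rightarrow> complex) \<Rightarrow> ('a \<Rightarrow> complex)) \<Rightarrow> complex" where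
  "trace_on W \<phi> =
     (let B = (SOME B. B \<subseteq> W \<and> fun_vs.independent B \<and> fun_vs.span B = W)
      in \<Sum>b\<in>B. fun_vs.representation B (\<phi> b) b)"

definition sym_char :: "nat list \<Rightarrow> (nat \<Rightarrow> nat) \<Rightarrow> complex" where
  "sym_char \<mu> \<sigma> = trace_on (specht_module \<mu>) (left_translate \<sigma>)"

text \<open>The polynomial ring over \<open>\<complex>\<close> in the indeterminates \<open>p\<^bsub>d,c\<^esub>\<close>. Only those with
  \<open>d \<ge> 1\<close> and \<open>c\<close> an \<open>r\<close>-th root of unity occur below.\<close>

type_synonym ppoly = "((nat \<times> complex) \<Rightarrow>\<^sub>0 nat) \<Rightarrow>\<^sub>0 complex"

definition pconst :: "complex \<Rightarrow> ppoly" where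
  "pconst a = Poly_Mapping.single 0 a"

definition pvar :: "nat \<Rightarrow> complex \<Rightarrow> ppoly" where
  "pvar d c = Poly_Mapping.single (Poly_Mapping.single (d, c) 1) 1"

definition roots_of_unity :: "nat \<Rightarrow> complex set" where
  "roots_of_unity r = {c. c ^ r = 1}"

text \<open>The character \<open>\<gamma>\<^sub>k\<close> of the cyclic group, determined by \<open>\<gamma>\<^sub>k(\<zeta>) = \<zeta>\<^sup>k\<close> on the generator
  \<open>\<zeta> = exp(2\<pi>i/r)\<close>, is \<open>c \<mapsto> c\<^sup>k\<close>.\<close>

definition power_sum :: "nat \<Rightarrow> nat \<Rightarrow> nat \<Rightarrow> ppoly" where
  "power_sum r d k = pconst (1 / of_nat r) * (\<Sum>c\<in>roots_of_unity r. pconst (c ^ k) * pvar d c)"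

text \<open>The cycles of \<open>\<sigma>\<close> on \<open>{0,\<dots>,m-1}\<close> (fixed points included), as sets.\<close>

definition cycle_sets :: "nat \<Rightarrow> (nat \<Rightarrow> nat) \<Rightarrow> nat set set" where
  "cycle_sets m \<sigma> = Orbits.orbit \<sigma> ` {..<m}"

definition schur :: "nat \<Rightarrow> nat \<Rightarrow> nat list \<Rightarrow> ppoly" where
  "schur r k \<mu> = pconst (1 / fact (sum_list \<mu>)) *
     (\<Sum>\<sigma>\<in>symgrp (sum_list \<mu>).
        pconst (sym_char \<mu> \<sigma>) * (\<Prod>C\<in>cycle_sets (sum_list \<mu>) \<sigma>. power_sum r (card C) k))"

text \<open>A monomial matrix \<open>g\<close> maps the \<open>j\<close>-th unit vector to a multiple of the unit vector with
  index \<open>perm_of n g j\<close>. The blocks of \<open>g\<close> correspond to the cycles of this permutation. Writing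
  the block belonging to a cycle \<open>C\<close> as \<open>\<delta>\<sigma>\<close> with \<open>\<delta>\<close> diagonal and \<open>\<sigma>\<close> a cyclic permutation
  matrix, the diagonal entries of \<open>\<delta>\<close> are the nonzero entries of the block, so that \<open>det \<delta>\<close> is
  their product, and the order of \<open>\<sigma>\<close> is \<open>card C\<close>.\<close>

definition perm_of :: "nat \<Rightarrow> complex mat \<Rightarrow> nat \<Rightarrow> nat" where
  "perm_of n g j = (if j < n then THE i. i < n \<and> g $$ (i,j) \<noteq> 0 else j)"

definition cycle_product :: "nat \<Rightarrow> complex mat \<Rightarrow> nat set \<Rightarrow> complex" where
  "cycle_product n g C = (\<Prod>j\<in>C. g $$ (perm_of n g j, j))"

definition cycle_type_monomial :: "nat \<Rightarrow> complex mat \<Rightarrow> ppoly" where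
  "cycle_type_monomial n g =
     (\<Prod>C\<in>cycle_sets n (perm_of n g). pvar (card C) (cycle_product n g C))"

text \<open>The following says that \<open>\<chi>\<close> is the irreducible character \<open>\<chi>\<^sub>\<lambda>\<close>. The identity determines
  \<open>\<chi>\<close> on the group uniquely, since a character is constant on conjugacy classes and the monomials
  of distinct classes are distinct.\<close>

definition is_indexed_character ::
    "nat \<Rightarrow> nat \<Rightarrow> nat list list \<Rightarrow> (complex mat \<Rightarrow> complex) \<Rightarrow> bool" where
  "is_indexed_character r n lam \<chi> \<longleftrightarrow>
     irreducible_character n (grn r n) \<chi> \<and>
     (\<Prod>k<r. schur r k (lam ! k)) =
       pconst (1 / of_nat (card (grn r n))) *
         (\<Sum>g\<in>grn r n. pconst (\<chi> g) * cycle_type_monomial n g)"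

definition poincare_poly :: "nat \<Rightarrow> nat \<Rightarrow> (complex mat \<Rightarrow> complex) \<Rightarrow> complex poly" where
  "poincare_poly r n \<chi> =
     Polynomial.smult (1 / \<chi> (1\<^sub>m n)) (\<Sum>w\<in>grn r n. Polynomial.monom (\<chi> w) (fixed_dim n w))"

end

(* Substituting t for the indeterminates p_{d,1} and 1 for all other p_{d,c} turns P_g into
   t^(dim V^g), because every block of g with cycle-product 1 contributes one dimension to the fixed
   space and the other blocks contribute none. At the same time p_{d,0} becomes (t+r-1)/r and p_{d,k},
   for 0 < k < r, becomes (t-1)/r, independently of d. The defining identity of chi_lambda then
   expresses the Poincare polynomial, up to a constant factor, as the product over k of the sums
   sum_sigma chi_mu(sigma) x^(cycles of sigma) with mu = lambda(k).

   The class function sigma -> x^(cycles of sigma) gives a central element Z of the group algebra.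
   By von Neumann's lemma, Z multiplies the Young symmetrizer ab by a scalar, namely the coefficient
   of the identity in Z a b, and so acts on the Specht module by this scalar. Removing the largest
   entry of the tableau shows by induction that the scalar is the product of x + c over the contents c.
   Hence each sum is a constant times this product. The remaining constant need not be computed
   (no hook formula is needed), since both sides of the theorem are monic of degree n. *)

theory Submission
  imports Defs
begin

section \<open>Counting cycles\<close>

text \<open>Centrality gives Z a b = a Z b, and a Z b is unchanged by row permutations from the left
  and picks up the sign of column permutations from the right. Such a function vanishes off the
  products of a row and a column permutation and is fixed by its value at the identity. For a b that
  value is 1, because a permutation preserving all rows and all columns is trivial; this is why the
  scalar is a coefficient at the identity. The induction on the largest entry shapes the setting. It
  passes through all shapes formed by initial segments of the entries, and the stabilizers of the
  smaller tableau must sit inside those of the larger one. Hence a tableau is a pair of label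
  functions \<open>rw\<close>, \<open>cl\<close> on the naturals, and only the bound
  \<open>m\<close> varies. The passage from the scalar to the character is a trace: a scalar
  operator has trace dimension times scalar, so the unknown constant of each shape is the dimension
  of its Specht module. The factor r in front of the contents comes from the denominator of the
  specialized power sums: x + c with x = (t - 1) / r equals (t - 1 + r c) / r.\<close>

definition num_cycles :: "nat \<Rightarrow> (nat \<Rightarrow> nat) \<Rightarrow> nat" where
  "num_cycles m \<sigma> = card (cycle_sets m \<sigma>)"

text \<open>An \<open>orbit\<close> is generated from the image of its starting point, so a point
  belongs to its own orbit only because a permutation of a finite set returns to it.\<close>

lemma self_in_orbit:
  assumes "\<sigma> permutes {..<m::nat}"
  shows "x \<in> orbit \<sigma> x"
  using assms by (intro permutation_self_in_orbit) (auto simp: permutation_permutes)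

lemma orbit_eq:
  assumes "\<sigma> permutes {..<m::nat}" "y \<in> orbit \<sigma> x"
  shows "orbit \<sigma> y = orbit \<sigma> x"
  using assms by (metis cyclic_on_orbit finite_lessThan orbit_cyclic_eq3)

lemma orbit_conj:
  assumes "\<And>x. g (h x) = h (f x)"
  shows "orbit g (h x) = h ` orbit f x"
proof (intro equalityI subsetI)
  fix y assume "y \<in> orbit g (h x)"
  then show "y \<in> h ` orbit f x"
    by induct (auto simp: assms intro: orbit.intros imageI)
next
  fix y assume "y \<in> h ` orbit f x"
  then obtain z where "z \<in> orbit f x" "y = h z" by auto
  from this(1) have "h z \<in> orbit g (h x)"
    by induct (auto simp: assms[symmetric] intro: orbit.intros)
  then show "y \<in> orbit g (h x)" using \<open>y = h z\<close> by simp
qed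

text \<open>The two products are conjugate by \<open>\<sigma>\<close>, which therefore carries the
  cycles of one bijectively to the cycles of the other.\<close>

lemma num_cycles_comp_commute:
  assumes "\<sigma> permutes {..<m}" "\<tau> permutes {..<m}"
  shows "num_cycles m (\<sigma> \<circ> \<tau>) = num_cycles m (\<tau> \<circ> \<sigma>)"
proof -
  have "orbit (\<sigma> \<circ> \<tau>) (\<sigma> x) = \<sigma> ` orbit (\<tau> \<circ> \<sigma>) x" for x
    by (rule orbit_conj) simp
  then have "cycle_sets m (\<sigma> \<circ> \<tau>) = image \<sigma> ` cycle_sets m (\<tau> \<circ> \<sigma>)"
    unfolding cycle_sets_def using permutes_image[OF assms(1)]
    by (metis (no_types, lifting) image_cong image_image)
  moreover have "inj_on (image \<sigma>) A" for A
    using permutes_inj[OF assms(1)] by (auto simp: inj_on_def inj_image_eq_iff)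
  ultimately show ?thesis
    unfolding num_cycles_def by (metis card_image)
qed

lemma orbit_fixpoint: "\<sigma> x = x \<Longrightarrow> orbit \<sigma> x = {x}"
  by (simp add: orbit_eq_singleton_iff)

lemma num_cycles_Suc:
  assumes "\<sigma> permutes {..<m}"
  shows "num_cycles (Suc m) \<sigma> = Suc (num_cycles m \<sigma>)"
proof -
  have "\<sigma> m = m" using assms by (simp add: permutes_def)
  then have "cycle_sets (Suc m) \<sigma> = insert {m} (cycle_sets m \<sigma>)"
    unfolding cycle_sets_def lessThan_Suc by (simp add: orbit_fixpoint)
  moreover have "{m} \<notin> cycle_sets m \<sigma>"
    unfolding cycle_sets_def using permutes_orbit_subset[OF assms] by fastforce
  ultimately show ?thesis
    unfolding num_cycles_def by (simp add: cycle_sets_def)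
qed

text \<open>The product with the transposition inserts \<open>m\<close> into an existing cycle,
  between \<open>b\<close> and \<open>\<sigma> b\<close>, and leaves the other cycles alone.\<close>

lemma num_cycles_comp_transpose:
  assumes s: "\<sigma> permutes {..<m}" and b: "b < m"
  shows "num_cycles (Suc m) (\<sigma> \<circ> transpose m b) = num_cycles m \<sigma>"
proof -
  define g where "g = \<sigma> \<circ> transpose m b"
  have sm: "\<sigma> m = m" using s by (simp add: permutes_def)
  have gb: "g b = m" and gm: "g m = \<sigma> b"
    and g: "\<And>x. x \<noteq> b \<Longrightarrow> x \<noteq> m \<Longrightarrow> g x = \<sigma> x"
    using b by (auto simp: g_def sm transpose_def)
  have gperm: "g permutes {..<Suc m}"
    unfolding g_def
    by (rule permutes_compose[OF permutes_swap_id])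
      (use b s in \<open>auto intro: permutes_subset\<close>)
  have sne: "\<sigma> x \<noteq> m" if "x \<noteq> m" for x
    using permutes_inj[OF s] sm that by (metis injD)
  \<comment> \<open>Deletes \<open>m\<close> from a cycle by collapsing it onto its predecessor
    \<open>b\<close>.\<close>
  define r where "r y = (if y = m then b else y)" for y
  have fwd: "y \<in> orbit g x" if "y \<in> orbit \<sigma> x" "x < m" for x y
    using that
  proof induct
    case base
    show ?case
      using base g[of x] gb gm by (cases "x = b") (metis orbit.intros less_irrefl)+
  next
    case (step y)
    then have "y < m" using permutes_orbit_subset[OF s, of x] by auto
    then show ?case
      using step g[of y] gb gm by (cases "y = b") (metis orbit.intros less_irrefl)+
  qed
  have bwd: "r y \<in> orbit \<sigma> x" if "y \<in> orbit g x" "x < m" for x y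
    using that
  proof induct
    case base
    show ?case
      using base g[of x] gb sne[of x] b self_in_orbit[OF s, of b]
      by (cases "x = b") (auto simp: r_def intro: orbit.intros)
  next
    case (step y)
    then have "r y \<in> orbit \<sigma> x" by simp
    then show ?case
      using g[of y] gb gm b sne[of y]
      by (cases "y = m"; cases "y = b"; cases "g y = m") (auto simp: r_def intro: orbit.intros)
  qed
  \<comment> \<open>Effect of the insertion on a cycle; removing \<open>m\<close> undoes it, so no
    two cycles are merged.\<close>
  define h where "h B = (if b \<in> B then insert m B else B)" for B
  have sub: "orbit \<sigma> x \<subseteq> {..<m}" if "x < m" for x
    using permutes_orbit_subset[OF s] that by simp
  have orb: "orbit g x = h (orbit \<sigma> x)" if x: "x < m" for x
  proof (intro equalityI subsetI)
    fix y assume "y \<in> orbit g x"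
    then show "y \<in> h (orbit \<sigma> x)"
      using bwd[of y x] x by (auto simp: h_def r_def split: if_splits)
  next
    fix y assume y: "y \<in> h (orbit \<sigma> x)"
    show "y \<in> orbit g x"
    proof (cases "y \<in> orbit \<sigma> x")
      case True then show ?thesis using fwd x by simp
    next
      case False
      then have "y = m" "b \<in> orbit \<sigma> x" using y by (auto simp: h_def split: if_splits)
      then show ?thesis using fwd[OF _ x, of b] gb orbit.step by metis
    qed
  qed
  \<comment> \<open>Since \<open>m\<close> shares the cycle of \<open>b\<close>, the points below
    \<open>m\<close> already reach every cycle of \<open>g\<close>.\<close>
  have "m \<in> orbit g b" using gb by (metis orbit.base)
  then have "orbit g m = orbit g b" using orbit_eq[OF gperm] by simp
  then have "cycle_sets (Suc m) g = orbit g ` {..<m}"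
    unfolding cycle_sets_def lessThan_Suc using b by auto
  also have "\<dots> = h ` cycle_sets m \<sigma>"
    unfolding cycle_sets_def by (auto simp: orb)
  finally have "cycle_sets (Suc m) g = h ` cycle_sets m \<sigma>" .
  moreover have "inj_on h (cycle_sets m \<sigma>)"
  proof (rule inj_on_inverseI)
    fix B assume "B \<in> cycle_sets m \<sigma>"
    then have "m \<notin> B" using sub unfolding cycle_sets_def by auto
    then show "h B - {m} = B" by (auto simp: h_def)
  qed
  ultimately show ?thesis
    unfolding num_cycles_def g_def[symmetric] by (simp add: card_image)
qed

text \<open>Moving \<open>w\<close> cyclically to the front brings the transposition to the right
  end, where it can be cut off.\<close>

lemma num_cycles_insert:
  assumes u: "u permutes {..<m}" and w: "w permutes {..<m}" and b: "b < m"
  shows "num_cycles (Suc m) (u \<circ> transpose m b \<circ> w) = num_cycles m (u \<circ> w)"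
proof -
  have *: "v permutes {..<Suc m}" if "v permutes {..<m}" for v
    using that by (auto intro: permutes_subset)
  have "num_cycles (Suc m) (u \<circ> transpose m b \<circ> w)
      = num_cycles (Suc m) (w \<circ> (u \<circ> transpose m b))"
    using b by (intro num_cycles_comp_commute permutes_compose permutes_swap_id * u w) auto
  also have "\<dots> = num_cycles m (w \<circ> u)"
    using num_cycles_comp_transpose[OF permutes_compose[OF u w] b] by (simp add: comp_assoc)
  also have "\<dots> = num_cycles m (u \<circ> w)"
    by (rule num_cycles_comp_commute[OF w u])
  finally show ?thesis .
qed

section \<open>Row and column stabilizers of a standard filling\<close>

text \<open>With row or column labels for \<open>f\<close> this is the row or column stabilizer.
  Preserving labels, instead of mapping blocks onto themselves, makes the group for \<open>m\<close>
  a subgroup of the one for \<open>Suc m\<close> with the same \<open>f\<close>.\<close>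

definition fiber_stabilizer :: "nat \<Rightarrow> (nat \<Rightarrow> nat) \<Rightarrow> (nat \<Rightarrow> nat) set" where
  "fiber_stabilizer m f = {p. p permutes {..<m} \<and> (\<forall>e. f (p e) = f e)}"

lemma finite_fiber_stabilizer: "finite (fiber_stabilizer m f)"
  by (rule finite_subset[OF _ finite_permutations[of "{..<m}"]]) (auto simp: fiber_stabilizer_def)

lemma fiber_stabilizer_permutes: "p \<in> fiber_stabilizer m f \<Longrightarrow> p permutes {..<m}"
  by (simp add: fiber_stabilizer_def)

lemma id_in_fiber_stabilizer: "id \<in> fiber_stabilizer m f"
  by (simp add: fiber_stabilizer_def permutes_id)

lemma comp_in_fiber_stabilizer:
  "p \<in> fiber_stabilizer m f \<Longrightarrow> q \<in> fiber_stabilizer m f \<Longrightarrow> p \<circ> q \<in> fiber_stabilizer m f"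
  by (auto simp: fiber_stabilizer_def intro: permutes_compose)

lemma inv_in_fiber_stabilizer:
  "p \<in> fiber_stabilizer m f \<Longrightarrow> inv_into UNIV p \<in> fiber_stabilizer m f"
  unfolding fiber_stabilizer_def
  by (auto intro: permutes_inv) (metis permutes_inverses(1))

lemma transpose_in_fiber_stabilizer:
  "a < m \<Longrightarrow> b < m \<Longrightarrow> f a = f b \<Longrightarrow> transpose a b \<in> fiber_stabilizer m f"
  by (auto simp: fiber_stabilizer_def transpose_def intro!: permutes_swap_id)

lemma fiber_stabilizer_Suc_mono: "p \<in> fiber_stabilizer m f \<Longrightarrow> p \<in> fiber_stabilizer (Suc m) f"
  by (auto simp: fiber_stabilizer_def intro: permutes_subset)

lemma sum_fiber_stabilizer_comp_right:
  assumes "t \<in> fiber_stabilizer m f"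
  shows "(\<Sum>p\<in>fiber_stabilizer m f. h (p \<circ> t)) = (\<Sum>p\<in>fiber_stabilizer m f. h p)"
  using permutes_inv_o[OF fiber_stabilizer_permutes[OF assms]] assms
  by (intro sum.reindex_bij_witness[where i="\<lambda>p. p \<circ> inv_into UNIV t" and j="\<lambda>p. p \<circ> t"])
    (auto simp: comp_assoc intro: comp_in_fiber_stabilizer inv_in_fiber_stabilizer)

lemma sum_fiber_stabilizer_comp_left:
  assumes "t \<in> fiber_stabilizer m f"
  shows "(\<Sum>p\<in>fiber_stabilizer m f. h (t \<circ> p)) = (\<Sum>p\<in>fiber_stabilizer m f. h p)"
  using permutes_inv_o[OF fiber_stabilizer_permutes[OF assms]] assms
  by (intro sum.reindex_bij_witness[where i="\<lambda>p. inv_into UNIV t \<circ> p" and j="\<lambda>p. t \<circ> p"])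
    (auto simp: comp_assoc[symmetric] intro: comp_in_fiber_stabilizer inv_in_fiber_stabilizer)

lemma sum_fiber_stabilizer_inv:
  "(\<Sum>p\<in>fiber_stabilizer m f. h (inv_into UNIV p)) = (\<Sum>p\<in>fiber_stabilizer m f. h p)"
  by (intro sum.reindex_bij_witness[where i="inv_into UNIV" and j="inv_into UNIV"])
    (auto simp: inv_in_fiber_stabilizer permutes_inv_inv dest: fiber_stabilizer_permutes)

text \<open>Coset decomposition by the image \<open>b = q m\<close>: undoing it with the
  transposition leaves an element that fixes \<open>m\<close>. The index \<open>b = m\<close> gives
  the subgroup itself, the transposition then being the identity.\<close>

lemma sum_fiber_stabilizer_Suc_left:
  "(\<Sum>q\<in>fiber_stabilizer (Suc m) f. h q)
   = (\<Sum>b | b \<le> m \<and> f b = f m. \<Sum>q\<in>fiber_stabilizer m f. h (transpose m b \<circ> q))"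
proof -
  let ?B = "{b. b \<le> m \<and> f b = f m}"
  have "(\<Sum>q\<in>fiber_stabilizer (Suc m) f. h q)
      = (\<Sum>(b, q)\<in>?B \<times> fiber_stabilizer m f. h (transpose m b \<circ> q))"
  proof (rule sum.reindex_bij_witness[where j="\<lambda>q. (q m, transpose m (q m) \<circ> q)"
        and i="\<lambda>(b, q). transpose m b \<circ> q"])
    fix q assume q: "q \<in> fiber_stabilizer (Suc m) f"
    then have qp: "q permutes {..<Suc m}" by (rule fiber_stabilizer_permutes)
    then have qm: "q m \<le> m" using permutes_in_image[OF qp, of m] by simp
    have "q permutes insert m {..<m}" using qp by (simp add: lessThan_Suc)
    then have "transpose m (q m) \<circ> q permutes {..<m}" by (rule permutes_insert_lemma)
    moreover have "f (transpose m (q m) (q e)) = f e" for e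
      using q by (simp add: fiber_stabilizer_def transpose_def) metis
    ultimately show "(q m, transpose m (q m) \<circ> q) \<in> ?B \<times> fiber_stabilizer m f"
      using q qm by (simp add: fiber_stabilizer_def)
    show "(case (q m, transpose m (q m) \<circ> q) of (b, q) \<Rightarrow> transpose m b \<circ> q) = q"
      by (simp add: comp_assoc[symmetric])
    then show "(case (q m, transpose m (q m) \<circ> q) of (b, q) \<Rightarrow> h (transpose m b \<circ> q)) = h q"
      by simp
  next
    fix z assume "z \<in> ?B \<times> fiber_stabilizer m f"
    then obtain b q where z: "z = (b, q)" "b \<le> m" "f b = f m" "q \<in> fiber_stabilizer m f" by auto
    have "q m = m" using fiber_stabilizer_permutes[OF z(4)] by (simp add: permutes_def)
    then show "((case z of (b, q) \<Rightarrow> transpose m b \<circ> q) m,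
        transpose m ((case z of (b, q) \<Rightarrow> transpose m b \<circ> q) m)
          \<circ> (case z of (b, q) \<Rightarrow> transpose m b \<circ> q)) = z"
      using z by (simp add: comp_assoc[symmetric])
    have "transpose m b \<in> fiber_stabilizer (Suc m) f"
      using z by (intro transpose_in_fiber_stabilizer) auto
    then show "(case z of (b, q) \<Rightarrow> transpose m b \<circ> q) \<in> fiber_stabilizer (Suc m) f"
      using comp_in_fiber_stabilizer fiber_stabilizer_Suc_mono[OF z(4)] z(1) by auto
  qed
  then show ?thesis by (simp add: sum.cartesian_product)
qed

text \<open>Inversion moves the transposition to the other side. With rows split on the right and
  columns on the left, both transpositions meet in the middle of \<open>p \<circ> q\<close>.\<close>

lemma sum_fiber_stabilizer_Suc_right:
  "(\<Sum>q\<in>fiber_stabilizer (Suc m) f. h q)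
   = (\<Sum>b | b \<le> m \<and> f b = f m. \<Sum>q\<in>fiber_stabilizer m f. h (q \<circ> transpose m b))"
proof -
  have "(\<Sum>q\<in>fiber_stabilizer (Suc m) f. h q)
      = (\<Sum>b | b \<le> m \<and> f b = f m. \<Sum>q\<in>fiber_stabilizer m f. h (inv_into UNIV (transpose m b \<circ> q)))"
    unfolding sum_fiber_stabilizer_inv[of h "Suc m", symmetric]
    by (rule sum_fiber_stabilizer_Suc_left)
  also have "\<dots> = (\<Sum>b | b \<le> m \<and> f b = f m. \<Sum>q\<in>fiber_stabilizer m f. h (inv_into UNIV q \<circ> transpose m b))"
    by (intro sum.cong refl)
      (simp add: o_inv_distrib permutes_bij[OF fiber_stabilizer_permutes])
  also have "\<dots> = (\<Sum>b | b \<le> m \<and> f b = f m. \<Sum>q\<in>fiber_stabilizer m f. h (q \<circ> transpose m b))"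
    by (intro sum.cong refl sum_fiber_stabilizer_inv)
  finally show ?thesis .
qed

section \<open>Functions with the symmetries of the Young symmetrizer\<close>

text \<open>The coefficient at \<open>\<tau>\<close> of the product a \<open>\<phi>\<close> b in the
  group algebra, with a the row sum and b the signed column sum: replacing \<open>p\<close> and
  \<open>q\<close> by their inverses changes neither the stabilizers nor the signs.\<close>

definition young_sum ::
    "nat \<Rightarrow> (nat \<Rightarrow> nat) \<Rightarrow> (nat \<Rightarrow> nat) \<Rightarrow> grpalg \<Rightarrow> (nat \<Rightarrow> nat) \<Rightarrow> complex" where
  "young_sum m rw cl \<phi> \<tau> =
     (\<Sum>p\<in>fiber_stabilizer m rw. \<Sum>q\<in>fiber_stabilizer m cl. of_int (sign q) * \<phi> (p \<circ> \<tau> \<circ> q))"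

lemma permutation_fiber_stabilizer: "p \<in> fiber_stabilizer m f \<Longrightarrow> permutation p"
  by (auto simp: permutation_permutes dest: fiber_stabilizer_permutes)

lemma young_sum_comp_right:
  assumes "q \<in> fiber_stabilizer m cl"
  shows "young_sum m rw cl \<phi> (\<tau> \<circ> q) = of_int (sign q) * young_sum m rw cl \<phi> \<tau>"
proof -
  have s: "of_int (sign q') = of_int (sign q) * (of_int (sign (q \<circ> q')) :: complex)"
    if "q' \<in> fiber_stabilizer m cl" for q'
    using sign_compose[OF permutation_fiber_stabilizer[OF assms] permutation_fiber_stabilizer[OF that]]
    by (auto simp: sign_def)
  have "(\<Sum>q'\<in>fiber_stabilizer m cl. of_int (sign q') * \<phi> (p \<circ> (\<tau> \<circ> q) \<circ> q'))
    = (\<Sum>q'\<in>fiber_stabilizer m cl. of_int (sign q) * (of_int (sign q') * \<phi> (p \<circ> \<tau> \<circ> q')))"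
    (is "_ = ?rhs") for p
  proof -
    have "(\<Sum>q'\<in>fiber_stabilizer m cl. of_int (sign q') * \<phi> (p \<circ> (\<tau> \<circ> q) \<circ> q'))
      = (\<Sum>q'\<in>fiber_stabilizer m cl.
          of_int (sign q) * (of_int (sign (q \<circ> q')) * \<phi> (p \<circ> \<tau> \<circ> (q \<circ> q'))))"
      by (intro sum.cong refl, subst s, simp_all add: comp_assoc)
    also have "\<dots> = ?rhs"
      by (rule sum_fiber_stabilizer_comp_left[OF assms])
    finally show ?thesis .
  qed
  then show ?thesis
    unfolding young_sum_def by (simp add: sum_distrib_left)
qed

lemma young_sum_comp_left:
  assumes "p \<in> fiber_stabilizer m rw"
  shows "young_sum m rw cl \<phi> (p \<circ> \<tau>) = young_sum m rw cl \<phi> \<tau>"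
  unfolding young_sum_def
  using sum_fiber_stabilizer_comp_right[OF assms, where h="\<lambda>p'.
      \<Sum>q\<in>fiber_stabilizer m cl. of_int (sign q) * \<phi> (p' \<circ> \<tau> \<circ> q)"]
  by (simp add: comp_assoc)

text \<open>A transposition inside a column, conjugated by \<open>\<tau>\<close>, becomes one inside
  a row. Absorbed on the right it changes the sign, absorbed on the left it does not, so the value
  is its own negative.\<close>

lemma young_sum_eq_0:
  assumes "\<tau> permutes {..<m}" "a < m" "b < m" "a \<noteq> b" "cl a = cl b" "rw (\<tau> a) = rw (\<tau> b)"
  shows "young_sum m rw cl \<phi> \<tau> = 0"
proof -
  have "\<tau> a < m" "\<tau> b < m"
    using assms permutes_in_image[OF assms(1)] by auto
  then have t: "transpose (\<tau> a) (\<tau> b) \<in> fiber_stabilizer m rw"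
    using assms by (intro transpose_in_fiber_stabilizer)
  have t': "transpose a b \<in> fiber_stabilizer m cl"
    using assms by (intro transpose_in_fiber_stabilizer)
  have "transpose (\<tau> a) (\<tau> b) \<circ> \<tau> = \<tau> \<circ> transpose a b"
    using permutes_inj[OF assms(1)] by (auto simp: fun_eq_iff transpose_def dest: injD)
  then have "young_sum m rw cl \<phi> \<tau> = of_int (sign (transpose a b)) * young_sum m rw cl \<phi> \<tau>"
    using young_sum_comp_left[OF t] young_sum_comp_right[OF t'] by metis
  then show ?thesis using assms by (simp add: sign_swap_id)
qed

section \<open>Standard fillings and the product over the contents\<close>

text \<open>All boxes weakly above and to the left of an entry hold entries that are at most as
  large. Thus the boxes form a Young diagram, and so do those of every initial segment of entries,
  which is what allows the largest entry to be removed.\<close>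

definition standard_filling :: "nat \<Rightarrow> (nat \<Rightarrow> nat) \<Rightarrow> (nat \<Rightarrow> nat) \<Rightarrow> bool" where
  "standard_filling m rw cl \<longleftrightarrow>
     inj_on (\<lambda>e. (rw e, cl e)) {..<m} \<and>
     (\<forall>e<m. \<forall>i\<le>rw e. \<forall>j\<le>cl e. \<exists>e'\<le>e. rw e' = i \<and> cl e' = j)"

lemma standard_filling_swap: "standard_filling m rw cl \<Longrightarrow> standard_filling m cl rw"
  unfolding standard_filling_def inj_on_def by (simp add: conj_commute)

lemma standard_filling_unique:
  "standard_filling m rw cl \<Longrightarrow> a < m \<Longrightarrow> b < m \<Longrightarrow> rw a = rw b \<Longrightarrow> cl a = cl b \<Longrightarrow> a = b"
  unfolding standard_filling_def inj_on_def by simp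

lemma standard_filling_below:
  assumes "standard_filling m rw cl" "e < m" "i \<le> rw e" "j \<le> cl e"
  obtains e' where "e' \<le> e" "rw e' = i" "cl e' = j"
  using assms unfolding standard_filling_def by meson

lemma standard_filling_Suc: "standard_filling (Suc m) rw cl \<Longrightarrow> standard_filling m rw cl"
  unfolding standard_filling_def by (auto simp: inj_on_def)

text \<open>The earlier entries in the row of \<open>m\<close> occupy exactly the columns left of
  it: one in a column further right would force an entry before \<open>m\<close> into the box of
  \<open>m\<close>. Applied to rows and, after a swap, to columns, this produces the two halves of
  the content.\<close>

lemma card_row_before:
  assumes "standard_filling (Suc m) rw cl"
  shows "card {e. e < m \<and> rw e = rw m} = cl m"
proof -
  let ?E = "{e. e < m \<and> rw e = rw m}"
  have "inj_on cl ?E"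
    using standard_filling_unique[OF assms] by (auto simp: inj_on_def)
  moreover have "cl ` ?E = {..<cl m}"
  proof (intro equalityI subsetI)
    fix j assume "j \<in> cl ` ?E"
    then obtain e where e: "e < m" "rw e = rw m" "j = cl e" by auto
    show "j \<in> {..<cl m}"
    proof (rule ccontr)
      assume "j \<notin> {..<cl m}"
      then obtain e' where "e' \<le> e" "rw e' = rw m" "cl e' = cl m"
        using standard_filling_below[OF assms, of e "rw m" "cl m"] e by auto
      then show False using standard_filling_unique[OF assms, of e' m] e by simp
    qed
  next
    fix j assume j: "j \<in> {..<cl m}"
    then obtain e where e: "e \<le> m" "rw e = rw m" "cl e = j"
      using standard_filling_below[OF assms, of m "rw m" j] by auto
    then show "j \<in> cl ` ?E" using j by (cases "e = m") auto
  qed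
  ultimately show ?thesis using card_image by fastforce
qed

text \<open>Splitting off the largest entry \<open>m\<close> from both stabilizers leaves elements
  \<open>p (m b) (m b') q\<close> with \<open>b\<close> in the row and \<open>b'\<close> in the column of \<open>m\<close>. If both transpositions are
  nontrivial then removing \<open>m\<close> leaves \<open>p (b b') q\<close>, and these terms cancel because of the entry in the
  column of \<open>b\<close> and the row of \<open>b'\<close>.\<close>

lemma young_sum_num_cycles:
  assumes "standard_filling m rw cl"
  shows "young_sum m rw cl (\<lambda>\<sigma>. x ^ num_cycles m \<sigma>) id
    = (\<Prod>e<m. x + of_nat (cl e) - of_nat (rw e))"
  using assms
proof (induction m)
  case 0
  have "fiber_stabilizer 0 f = {id}" for f
    by (auto simp: fiber_stabilizer_def permutes_id)
  then show ?case
    by (simp add: young_sum_def num_cycles_def cycle_sets_def)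
next
  case (Suc m)
  let ?R = "fiber_stabilizer m rw" and ?C = "fiber_stabilizer m cl"
  let ?Rm = "{b. b < m \<and> rw b = rw m}" and ?Cm = "{b. b < m \<and> cl b = cl m}"
  let ?\<phi> = "\<lambda>\<sigma>. x ^ num_cycles m \<sigma>"
  let ?\<kappa> = "young_sum m rw cl ?\<phi>"
  define Y where "Y b b' = (\<Sum>p\<in>?R. \<Sum>q\<in>?C. of_int (sign q) *
      x ^ num_cycles (Suc m) (p \<circ> (transpose m b \<circ> transpose m b') \<circ> q))" for b b'
  \<comment> \<open>The sign of \<open>transpose m b\<close>, which is the identity for
    \<open>b = m\<close>.\<close>
  define \<epsilon> :: "nat \<Rightarrow> complex" where "\<epsilon> b = (if b = m then 1 else - 1)" for b
  have eps: "(\<Sum>b'\<in>?Cm. \<epsilon> b' * Y b b') = - (\<Sum>b'\<in>?Cm. Y b b')" for b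
    unfolding sum_negf[symmetric] by (intro sum.cong) (auto simp: \<epsilon>_def)
  note filling = standard_filling_Suc[OF Suc.prems]
  have perm: "p permutes {..<m}" if "p \<in> fiber_stabilizer m f" for p f
    using that by (rule fiber_stabilizer_permutes)
  have sign: "of_int (sign (transpose m b \<circ> q)) = \<epsilon> b * of_int (sign q)" if "q \<in> ?C" for b q
    using that by (simp add: \<epsilon>_def sign_compose permutation_swap_id permutation_fiber_stabilizer
        sign_swap_id)
  have "young_sum (Suc m) rw cl (\<lambda>\<sigma>. x ^ num_cycles (Suc m) \<sigma>) id
    = (\<Sum>b | b \<le> m \<and> rw b = rw m. \<Sum>p\<in>?R. \<Sum>b' | b' \<le> m \<and> cl b' = cl m. \<Sum>q\<in>?C.
        of_int (sign (transpose m b' \<circ> q)) *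
        x ^ num_cycles (Suc m) (p \<circ> transpose m b \<circ> id \<circ> (transpose m b' \<circ> q)))"
    unfolding young_sum_def sum_fiber_stabilizer_Suc_right[of _ m rw]
      sum_fiber_stabilizer_Suc_left[of _ m cl] ..
  also have "\<dots> = (\<Sum>b | b \<le> m \<and> rw b = rw m. \<Sum>p\<in>?R. \<Sum>b' | b' \<le> m \<and> cl b' = cl m. \<Sum>q\<in>?C.
        \<epsilon> b' * (of_int (sign q) *
        x ^ num_cycles (Suc m) (p \<circ> (transpose m b \<circ> transpose m b') \<circ> q)))"
    by (intro sum.cong refl) (simp add: sign comp_assoc mult.assoc)
  also have "\<dots> = (\<Sum>b | b \<le> m \<and> rw b = rw m. \<Sum>b' | b' \<le> m \<and> cl b' = cl m. \<epsilon> b' * Y b b')"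
    unfolding Y_def sum_distrib_left by (intro sum.cong refl sum.swap)
  also have "{b. b \<le> m \<and> rw b = rw m} = insert m ?Rm" by auto
  also have "{b. b \<le> m \<and> cl b = cl m} = insert m ?Cm" by auto
  also have "(\<Sum>b\<in>insert m ?Rm. \<Sum>b'\<in>insert m ?Cm. \<epsilon> b' * Y b b')
      = Y m m - (\<Sum>b'\<in>?Cm. Y m b') + ((\<Sum>b\<in>?Rm. Y b m) - (\<Sum>b\<in>?Rm. \<Sum>b'\<in>?Cm. Y b b'))"
    by (simp add: eps sum_negf sum_subtractf) (simp add: \<epsilon>_def)
  \<comment> \<open>Both transpositions are trivial, \<open>m\<close> is an additional fixed point,
    and this extra cycle contributes the factor \<open>x\<close>.\<close>
  also have "Y m m = x * ?\<kappa> id"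
    unfolding Y_def young_sum_def sum_distrib_left
    by (intro sum.cong refl)
      (simp add: num_cycles_Suc[OF permutes_compose[OF perm perm]])
  also have "(\<Sum>b'\<in>?Cm. Y m b') = of_nat (rw m) * ?\<kappa> id"
  proof -
    have "Y m b' = ?\<kappa> id" if "b' \<in> ?Cm" for b'
      unfolding Y_def young_sum_def
      using that by (intro sum.cong refl) (simp add: num_cycles_insert[OF perm perm])
    then show ?thesis
      using card_row_before[OF standard_filling_swap[OF Suc.prems]] by simp
  qed
  also have "(\<Sum>b\<in>?Rm. Y b m) = of_nat (cl m) * ?\<kappa> id"
  proof -
    have "Y b m = ?\<kappa> id" if "b \<in> ?Rm" for b
      unfolding Y_def young_sum_def
      using that by (intro sum.cong refl) (simp add: num_cycles_insert[OF perm perm])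
    then show ?thesis
      using card_row_before[OF Suc.prems] by simp
  qed
  also have "(\<Sum>b\<in>?Rm. \<Sum>b'\<in>?Cm. Y b b') = 0"
  proof (intro sum.neutral ballI)
    fix b b' assume b: "b \<in> ?Rm" and b': "b' \<in> ?Cm"
    have ne: "b \<noteq> b'"
      using b b' standard_filling_unique[OF Suc.prems, of b m] by auto
    then have t: "transpose m b \<circ> transpose m b' = transpose b b' \<circ> transpose m b"
      using b b' by (auto simp: fun_eq_iff transpose_def)
    have tp: "transpose b b' permutes {..<m}"
      using b b' by (intro permutes_swap_id) auto
    have "Y b b' = ?\<kappa> (transpose b b')"
      unfolding Y_def young_sum_def t
    proof (intro sum.cong refl)
      fix p q assume "p \<in> ?R" "q \<in> ?C"
      then show "of_int (sign q) * x ^ num_cycles (Suc m) (p \<circ> (transpose b b' \<circ> transpose m b) \<circ> q)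
          = of_int (sign q) * x ^ num_cycles m (p \<circ> transpose b b' \<circ> q)"
        using num_cycles_insert[OF permutes_compose[OF tp perm] perm, of p rw q cl b] b
        by (simp add: comp_assoc)
    qed
    also have "\<dots> = 0"
    proof -
      \<comment> \<open>As \<open>b\<close> is in the row of \<open>m\<close> and \<open>b'\<close>
        in its column, \<open>b\<close> must lie to the left: otherwise the box of \<open>m\<close>
        would already hold an entry at most \<open>b\<close>. So the box in the row of
        \<open>b'\<close> and the column of \<open>b\<close> is filled no later than
        \<open>b'\<close>.\<close>
      have "cl b \<le> cl b'"
      proof (rule ccontr)
        assume "\<not> cl b \<le> cl b'"
        then obtain e where "e \<le> b" "rw e = rw m" "cl e = cl m"
          using standard_filling_below[OF Suc.prems, of b "rw m" "cl m"] b b' by auto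
        then show False using standard_filling_unique[OF Suc.prems, of e m] b by auto
      qed
      then obtain v where v: "v \<le> b'" "rw v = rw b'" "cl v = cl b"
        using standard_filling_below[OF filling, of b' "rw b'" "cl b"] b' by auto
      have "v \<noteq> b" using v b b' standard_filling_unique[OF Suc.prems, of b' m] by auto
      moreover have "v \<noteq> b'" using v b b' standard_filling_unique[OF Suc.prems, of b m] by auto
      ultimately show ?thesis
        using v b b' by (intro young_sum_eq_0[OF tp, of v b]) (auto simp: transpose_def)
    qed
    finally show "Y b b' = 0" .
  qed
  also have "x * ?\<kappa> id - of_nat (rw m) * ?\<kappa> id + (of_nat (cl m) * ?\<kappa> id - 0)
      = ?\<kappa> id * (x + of_nat (cl m) - of_nat (rw m))"
    by (simp add: algebra_simps)
  finally show ?case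
    using Suc.IH[OF filling] by simp
qed

section \<open>Von Neumann's lemma for row and column stabilizers\<close>

text \<open>Exchange argument: the elements of the initial segment missing from \<open>S\<close> are
  all below \<open>card S\<close>, and equally many elements of \<open>S\<close> replace them, all
  of which are at least \<open>card S\<close>.\<close>

lemma sum_less_sum_nat_set:
  fixes S :: "nat set"
  assumes "finite S" "S \<noteq> {..<card S}"
  shows "\<Sum>{..<card S} < \<Sum>S"
proof -
  let ?k = "card S" and ?A = "S \<inter> {..<card S}"
  have eq: "card (S - ?A) = card ({..<?k} - ?A)"
    using assms by (simp add: card_Diff_subset)
  have "{..<?k} - ?A \<noteq> {}"
  proof
    assume "{..<?k} - ?A = {}"
    then have "{..<?k} \<subseteq> S" by auto
    then show False using card_subset_eq[OF assms(1), of "{..<?k}"] assms(2) by simp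
  qed
  then have "\<Sum>({..<?k} - ?A) < (\<Sum>i\<in>{..<?k} - ?A. ?k)"
    by (intro sum_strict_mono) auto
  also have "\<dots> = (\<Sum>i\<in>S - ?A. ?k)" using eq by simp
  also have "\<dots> \<le> \<Sum>(S - ?A)" by (intro sum_mono) auto
  finally have "\<Sum>({..<?k} - ?A) + \<Sum>?A < \<Sum>(S - ?A) + \<Sum>?A" by simp
  then show ?thesis
    using sum.subset_diff[of ?A S "\<lambda>i. i"] sum.subset_diff[of ?A "{..<?k}" "\<lambda>i. i"] assms by simp
qed

lemma sum_le_sum_nat_set: "finite (S :: nat set) \<Longrightarrow> \<Sum>{..<card S} \<le> \<Sum>S"
  using sum_less_sum_nat_set by (metis less_imp_le order_refl)

text \<open>The set of row numbers in a column is closed downwards, hence an initial segment of the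
  naturals.\<close>

lemma rows_of_column:
  assumes "standard_filling m rw cl"
  shows "rw ` {e. e < m \<and> cl e = j} = {..<card {e. e < m \<and> cl e = j}}"
proof -
  let ?E = "{e. e < m \<and> cl e = j}"
  have down: "i \<in> rw ` ?E" if "i' \<in> rw ` ?E" "i \<le> i'" for i i'
  proof -
    from that obtain e where "e < m" "cl e = j" "i \<le> rw e" by auto
    then obtain e' where "e' \<le> e" "rw e' = i" "cl e' = j"
      using standard_filling_below[OF assms, of e i j] by auto
    then show ?thesis using \<open>e < m\<close> by auto
  qed
  have inj: "inj_on rw ?E"
    using standard_filling_unique[OF assms] by (auto simp: inj_on_def)
  show ?thesis
  proof (cases "?E = {}")
    case False
    let ?M = "Max (rw ` ?E)"
    have fin: "finite (rw ` ?E)" by simp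
    have "?M \<in> rw ` ?E" using False by (intro Max_in) auto
    then have "{..?M} \<subseteq> rw ` ?E"
      using down by blast
    moreover have "rw ` ?E \<subseteq> {..?M}"
      using Max_ge[OF fin] by blast
    ultimately have "rw ` ?E = {..<Suc ?M}" by (simp add: lessThan_Suc_atMost)
    moreover from this have "card (rw ` ?E) = Suc ?M" by (metis card_lessThan)
    ultimately show ?thesis using card_image[OF inj] by simp
  next
    case True
    show ?thesis unfolding True by simp
  qed
qed

text \<open>Within each column the values of \<open>rw \<circ> \<tau>\<close> are distinct, so their sum is at least that of the
  row numbers of the column, with equality only for the same set of values. The total sums over all
  columns agree, so equality holds throughout.\<close>

lemma rows_of_permuted_column:
  assumes fill: "standard_filling m rw cl" and t: "\<tau> permutes {..<m}"
    and inj: "\<And>a b. a < m \<Longrightarrow> b < m \<Longrightarrow> cl a = cl b \<Longrightarrow> rw (\<tau> a) = rw (\<tau> b) \<Longrightarrow> a = b"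
  shows "(rw \<circ> \<tau>) ` {e. e < m \<and> cl e = j} = rw ` {e. e < m \<and> cl e = j}"
proof (cases "j \<in> cl ` {..<m}")
  case True
  let ?E = "\<lambda>j. {e. e < m \<and> cl e = j}"
  let ?S = "\<lambda>j. (rw \<circ> \<tau>) ` ?E j"
  have inj1: "inj_on (rw \<circ> \<tau>) (?E j)" for j
    using inj by (auto simp: inj_on_def)
  have inj2: "inj_on rw (?E j)" for j
    using standard_filling_unique[OF fill] by (auto simp: inj_on_def)
  have E: "{e \<in> {..<m}. cl e = j} = ?E j" for j by auto
  have sum_cols: "(\<Sum>e<m. g e) = (\<Sum>j\<in>cl ` {..<m}. \<Sum>e\<in>?E j. g e)" for g :: "nat \<Rightarrow> nat"
    by (subst sum.image_gen[where g=cl]) (simp_all add: E)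
  have card: "card (?S j) = card (?E j)" for j
    by (rule card_image[OF inj1])
  have row_sum: "(\<Sum>e\<in>?E j. rw e) = \<Sum>{..<card (?S j)}" for j
    using sum.reindex[OF inj2, of "\<lambda>i. i" j] rows_of_column[OF fill, of j] card
    by simp
  have row_sum': "(\<Sum>e\<in>?E j. rw (\<tau> e)) = \<Sum>(?S j)" for j
    using sum.reindex[OF inj1, of "\<lambda>i. i" j] by simp
  have "(\<Sum>e<m. rw e) = (\<Sum>e<m. rw (\<tau> e))"
    using sum.permute[OF t, of rw] by (simp add: o_def)
  then have "(\<Sum>j\<in>cl ` {..<m}. \<Sum>{..<card (?S j)}) = (\<Sum>j\<in>cl ` {..<m}. \<Sum>(?S j))"
    unfolding sum_cols row_sum row_sum' .
  then have "\<Sum>{..<card (?S j)} = \<Sum>(?S j)"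
    by (rule sum_mono_inv) (use True in \<open>auto intro: sum_le_sum_nat_set\<close>)
  then have "?S j = {..<card (?S j)}"
    using sum_less_sum_nat_set[of "?S j"] by fastforce
  then show ?thesis using rows_of_column[OF fill, of j] card by metis
next
  case False
  then have E: "{e. e < m \<and> cl e = j} = {}" by auto
  show ?thesis unfolding E by simp
qed

text \<open>The permuted rows of a column are again the rows of that column, so \<open>q\<close> can
  send each entry \<open>e\<close> to the entry of its own column that lies in the row of
  \<open>\<tau> e\<close>. What remains of \<open>\<tau>\<close> after dividing by \<open>q\<close>
  then preserves rows.\<close>

lemma row_col_factorization:
  assumes fill: "standard_filling m rw cl" and t: "\<tau> permutes {..<m}"
    and inj: "\<And>a b. a < m \<Longrightarrow> b < m \<Longrightarrow> cl a = cl b \<Longrightarrow> rw (\<tau> a) = rw (\<tau> b) \<Longrightarrow> a = b"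
  obtains p q where "p \<in> fiber_stabilizer m rw" "q \<in> fiber_stabilizer m cl" "\<tau> = p \<circ> q"
proof -
  have "\<exists>e'. e' < m \<and> cl e' = cl e \<and> rw e' = rw (\<tau> e)" if "e < m" for e
  proof -
    have "rw (\<tau> e) \<in> (rw \<circ> \<tau>) ` {e'. e' < m \<and> cl e' = cl e}" using that by auto
    moreover have "(rw \<circ> \<tau>) ` {e'. e' < m \<and> cl e' = cl e} = rw ` {e'. e' < m \<and> cl e' = cl e}"
      by (rule rows_of_permuted_column[OF fill t]) (rule inj)
    ultimately show ?thesis by auto
  qed
  then obtain q' where q': "\<And>e. e < m \<Longrightarrow> q' e < m \<and> cl (q' e) = cl e \<and> rw (q' e) = rw (\<tau> e)"
    by metis
  define q where "q e = (if e < m then q' e else e)" for e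
  have "inj_on q {..<m}"
  proof (rule inj_onI)
    fix a b assume "a \<in> {..<m}" "b \<in> {..<m}" "q a = q b"
    then show "a = b" using inj[of a b] q'[of a] q'[of b] by (simp add: q_def)
  qed
  moreover have "q ` {..<m} \<subseteq> {..<m}" using q' by (auto simp: q_def)
  ultimately have "bij_betw q {..<m} {..<m}"
    by (simp add: bij_betw_def endo_inj_surj)
  then have q: "q permutes {..<m}"
    by (rule bij_imp_permutes) (simp add: q_def)
  have qC: "q \<in> fiber_stabilizer m cl"
    using q q' by (simp add: fiber_stabilizer_def q_def)
  have rq: "rw (q e) = rw (\<tau> e)" for e
    using q' permutes_not_in[OF t, of e] by (simp add: q_def)
  have "rw ((\<tau> \<circ> inv_into UNIV q) e) = rw e" for e
    using rq[of "inv_into UNIV q e"] permutes_inverses(1)[OF q] by simp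
  then have "\<tau> \<circ> inv_into UNIV q \<in> fiber_stabilizer m rw"
    using permutes_compose[OF permutes_inv[OF q] t] by (simp add: fiber_stabilizer_def)
  moreover have "\<tau> = (\<tau> \<circ> inv_into UNIV q) \<circ> q"
    using permutes_inv_o(2)[OF q] by (simp add: comp_assoc)
  ultimately show ?thesis using that qC by blast
qed

text \<open>The entry \<open>q e\<close> has the column of \<open>e\<close> because \<open>q\<close>
  preserves columns, and its row because \<open>p\<close> preserves rows and maps it back to
  \<open>e\<close>. A box holds only one entry.\<close>

lemma fiber_stabilizers_comp_eq_id:
  assumes fill: "standard_filling m rw cl"
    and p: "p \<in> fiber_stabilizer m rw" and q: "q \<in> fiber_stabilizer m cl" and "p \<circ> q = id"
  shows "p = id \<and> q = id"
proof -
  have q_id: "q e = e" for e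
  proof (cases "e < m")
    case True
    have "q e < m" using True permutes_in_image[OF fiber_stabilizer_permutes[OF q]] by simp
    moreover have "rw (q e) = rw (p (q e))" "cl (q e) = cl e"
      using p q by (simp_all add: fiber_stabilizer_def)
    moreover have "p (q e) = e"
      using fun_cong[OF assms(4), of e] by simp
    ultimately show ?thesis
      using standard_filling_unique[OF fill _ True] by metis
  next
    case False
    then show ?thesis using permutes_not_in[OF fiber_stabilizer_permutes[OF q]] by simp
  qed
  then have "q = id" by auto
  then show ?thesis using assms(4) by simp
qed

definition delta_id :: grpalg where
  "delta_id \<tau> = (if \<tau> = id then 1 else 0)"

lemma young_sum_delta_id:
  assumes fill: "standard_filling m rw cl"
  shows "young_sum m rw cl delta_id id = 1"
proof -
  have "(\<Sum>q\<in>fiber_stabilizer m cl. of_int (sign q) * delta_id (p \<circ> id \<circ> q))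
      = (if p = id then 1 else 0)" if p: "p \<in> fiber_stabilizer m rw" for p
  proof -
    have "(\<Sum>q\<in>fiber_stabilizer m cl. of_int (sign q) * delta_id (p \<circ> id \<circ> q))
      = (\<Sum>q\<in>fiber_stabilizer m cl. if q = id then (if p = id then 1 else 0) else 0)"
      using fiber_stabilizers_comp_eq_id[OF fill p]
      by (intro sum.cong refl) (auto simp: delta_id_def sign_id)
    also have "\<dots> = (if p = id then 1 else 0)"
      using finite_fiber_stabilizer id_in_fiber_stabilizer by (simp add: sum.delta)
    finally show ?thesis .
  qed
  then have "young_sum m rw cl delta_id id
      = (\<Sum>p\<in>fiber_stabilizer m rw. if p = id then 1 else 0)"
    unfolding young_sum_def by (intro sum.cong refl) auto
  then show ?thesis
    using finite_fiber_stabilizer id_in_fiber_stabilizer by (simp add: sum.delta)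
qed

text \<open>Either two entries of one column land in one row and both sides vanish, or
  \<open>\<tau>\<close> factors as row times column permutation and both sides are the sign of the
  column part times the value at the identity. The value for \<open>delta_id\<close> at the identity
  is 1.\<close>

lemma young_sum_eq_delta:
  assumes fill: "standard_filling m rw cl" and t: "\<tau> permutes {..<m}"
  shows "young_sum m rw cl \<phi> \<tau> = young_sum m rw cl \<phi> id * young_sum m rw cl delta_id \<tau>"
proof (cases "\<exists>a b. a < m \<and> b < m \<and> a \<noteq> b \<and> cl a = cl b \<and> rw (\<tau> a) = rw (\<tau> b)")
  case True
  then show ?thesis using young_sum_eq_0[OF t] by (metis mult_zero_right)
next
  case False
  then obtain p q where pq: "p \<in> fiber_stabilizer m rw" "q \<in> fiber_stabilizer m cl" "\<tau> = p \<circ> q"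
    using row_col_factorization[OF fill t] by metis
  have "young_sum m rw cl \<psi> \<tau> = of_int (sign q) * young_sum m rw cl \<psi> id" for \<psi>
    using young_sum_comp_right[OF pq(2), of rw \<psi> p] young_sum_comp_left[OF pq(1), of cl \<psi> id] pq(3)
    by simp
  then show ?thesis by (simp add: young_sum_delta_id[OF fill])
qed

section \<open>The action on the Specht module\<close>

lemma symgrp_simps:
  "id \<in> symgrp m"
  "\<sigma> \<in> symgrp m \<Longrightarrow> \<tau> \<in> symgrp m \<Longrightarrow> \<sigma> \<circ> \<tau> \<in> symgrp m"
  "\<sigma> \<in> symgrp m \<Longrightarrow> inv_into UNIV \<sigma> \<in> symgrp m"
  "\<sigma> \<in> symgrp m \<Longrightarrow> inv_into UNIV (inv_into UNIV \<sigma>) = \<sigma>"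
  "\<sigma> \<in> symgrp m \<Longrightarrow> inv_into UNIV \<sigma> \<circ> \<sigma> = id"
  "\<sigma> \<in> symgrp m \<Longrightarrow> \<sigma> \<circ> inv_into UNIV \<sigma> = id"
  "finite (symgrp m)"
  unfolding symgrp_def
  by (auto simp: permutes_id permutes_compose permutes_inv permutes_inv_inv permutes_inv_o
      finite_permutations)

lemma symgrp_comp_cancel:
  fixes \<tau> :: "nat \<Rightarrow> nat"
  shows
  "\<sigma> \<in> symgrp m \<Longrightarrow> inv_into UNIV \<sigma> \<circ> (\<sigma> \<circ> \<tau>) = \<tau>"
  "\<sigma> \<in> symgrp m \<Longrightarrow> \<sigma> \<circ> (inv_into UNIV \<sigma> \<circ> \<tau>) = \<tau>"
  using symgrp_simps(5,6)[of \<sigma> m] by (simp_all add: comp_assoc[symmetric])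

lemma symgrp_comp_iff: "\<sigma> \<in> symgrp m \<Longrightarrow> \<sigma> \<circ> \<tau> \<in> symgrp m \<longleftrightarrow> \<tau> \<in> symgrp m"
  using symgrp_simps(2,3) symgrp_comp_cancel(1) by metis

lemma symgrp_inv_comp:
  assumes "\<sigma> \<in> symgrp m" "\<tau> \<in> symgrp m"
  shows "inv_into UNIV (\<sigma> \<circ> \<tau>) = inv_into UNIV \<tau> \<circ> inv_into UNIV \<sigma>"
  using assms by (intro o_inv_distrib permutes_bij) (auto simp: symgrp_def)

lemma fiber_stabilizer_symgrp: "p \<in> fiber_stabilizer m f \<Longrightarrow> p \<in> symgrp m"
  by (simp add: fiber_stabilizer_def symgrp_def)

text \<open>Writing the coefficient as a sum over all pairs \<open>p\<close>, \<open>q\<close> lets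
  later sums over the group be carried out first.\<close>

lemma young_symmetrizer_expand:
  assumes R: "row_stabilizer \<mu> = fiber_stabilizer (sum_list \<mu>) rw"
    and C: "col_stabilizer \<mu> = fiber_stabilizer (sum_list \<mu>) cl"
  shows "young_symmetrizer \<mu> \<tau> = (\<Sum>p\<in>fiber_stabilizer (sum_list \<mu>) rw.
    \<Sum>q\<in>fiber_stabilizer (sum_list \<mu>) cl. if \<tau> = p \<circ> q then of_int (sign q) else 0)"
proof -
  let ?m = "sum_list \<mu>"
  have "young_symmetrizer \<mu> \<tau>
      = (\<Sum>p\<in>fiber_stabilizer ?m rw. col_antisymmetrizer \<mu> (inv_into UNIV p \<circ> \<tau>))"
    unfolding young_symmetrizer_def conv_def row_symmetrizer_def R
    by (rule sum.mono_neutral_cong_right)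
      (auto simp: symgrp_simps(7) fiber_stabilizer_symgrp)
  also have "\<dots> = (\<Sum>p\<in>fiber_stabilizer ?m rw.
    \<Sum>q\<in>fiber_stabilizer ?m cl. if \<tau> = p \<circ> q then of_int (sign q) else 0)"
  proof (rule sum.cong[OF refl])
    fix p assume "p \<in> fiber_stabilizer ?m rw"
    then have "p \<in> symgrp ?m" by (rule fiber_stabilizer_symgrp)
    then have "\<tau> = p \<circ> q \<longleftrightarrow> q = inv_into UNIV p \<circ> \<tau>" for q
      using symgrp_comp_cancel by metis
    then show "col_antisymmetrizer \<mu> (inv_into UNIV p \<circ> \<tau>)
        = (\<Sum>q\<in>fiber_stabilizer ?m cl. if \<tau> = p \<circ> q then of_int (sign q) else 0)"
      by (simp add: col_antisymmetrizer_def C sum.delta finite_fiber_stabilizer)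
  qed
  finally show ?thesis .
qed

lemma young_symmetrizer_eq_young_sum:
  assumes R: "row_stabilizer \<mu> = fiber_stabilizer (sum_list \<mu>) rw"
    and C: "col_stabilizer \<mu> = fiber_stabilizer (sum_list \<mu>) cl"
  shows "young_symmetrizer \<mu> \<tau> = young_sum (sum_list \<mu>) rw cl delta_id \<tau>"
proof -
  let ?R = "fiber_stabilizer (sum_list \<mu>) rw" and ?C = "fiber_stabilizer (sum_list \<mu>) cl"
  have "young_sum (sum_list \<mu>) rw cl delta_id \<tau> = (\<Sum>p\<in>?R. \<Sum>q\<in>?C.
      of_int (sign (inv_into UNIV q)) * delta_id (inv_into UNIV p \<circ> \<tau> \<circ> inv_into UNIV q))"
    unfolding young_sum_def
    by (subst sum_fiber_stabilizer_inv[of _ _ rw, symmetric],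
        subst sum_fiber_stabilizer_inv[of _ _ cl, symmetric]) simp
  also have "\<dots> = (\<Sum>p\<in>?R. \<Sum>q\<in>?C. if \<tau> = p \<circ> q then of_int (sign q) else 0)"
  proof (intro sum.cong refl)
    fix p q assume p: "p \<in> ?R" and q: "q \<in> ?C"
    note pq = fiber_stabilizer_symgrp[OF p] fiber_stabilizer_symgrp[OF q]
    have "inv_into UNIV p \<circ> \<tau> \<circ> inv_into UNIV q = id \<longleftrightarrow> \<tau> = p \<circ> q"
    proof
      assume "inv_into UNIV p \<circ> \<tau> \<circ> inv_into UNIV q = id"
      then have "p \<circ> (inv_into UNIV p \<circ> \<tau> \<circ> inv_into UNIV q) \<circ> q = p \<circ> q" by simp
      then show "\<tau> = p \<circ> q"
        using symgrp_comp_cancel(2)[OF pq(1), of "\<tau> \<circ> inv_into UNIV q"] symgrp_simps(5)[OF pq(2)]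
        by (simp add: comp_assoc)
    next
      assume "\<tau> = p \<circ> q"
      then show "inv_into UNIV p \<circ> \<tau> \<circ> inv_into UNIV q = id"
        using symgrp_comp_cancel(1)[OF pq(1)] symgrp_simps(6)[OF pq(2)] by simp
    qed
    then show "of_int (sign (inv_into UNIV q)) * delta_id (inv_into UNIV p \<circ> \<tau> \<circ> inv_into UNIV q)
        = (if \<tau> = p \<circ> q then of_int (sign q) else 0)"
      by (simp add: delta_id_def sign_inverse[OF permutation_fiber_stabilizer[OF q]])
  qed
  finally show ?thesis
    using young_symmetrizer_expand[OF R C] by simp
qed

section \<open>Central elements acting by scalars\<close>

text \<open>Equivalent to invariance under conjugation; this form moves a factor from one end of a
  product to the other.\<close>

definition class_function :: "nat \<Rightarrow> grpalg \<Rightarrow> bool" where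
  "class_function m \<phi> \<longleftrightarrow> (\<forall>\<sigma>\<in>symgrp m. \<forall>\<tau>\<in>symgrp m. \<phi> (\<sigma> \<circ> \<tau>) = \<phi> (\<tau> \<circ> \<sigma>))"

lemma class_function_num_cycles: "class_function m (\<lambda>\<sigma>. x ^ num_cycles m \<sigma>)"
  using num_cycles_comp_commute by (simp add: class_function_def symgrp_def)

text \<open>By centrality \<open>\<phi>\<close> slides between the row and column parts of the
  symmetrizer. The result is the \<open>young_sum\<close> of \<open>\<phi>\<close>, which von
  Neumann's lemma makes a multiple of the symmetrizer.\<close>

lemma young_symmetrizer_eigen:
  assumes R: "row_stabilizer \<mu> = fiber_stabilizer (sum_list \<mu>) rw"
    and C: "col_stabilizer \<mu> = fiber_stabilizer (sum_list \<mu>) cl"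
    and fill: "standard_filling (sum_list \<mu>) rw cl"
    and cls: "class_function (sum_list \<mu>) \<phi>"
  shows "(\<Sum>s\<in>symgrp (sum_list \<mu>). \<phi> s * young_symmetrizer \<mu> (inv_into UNIV s \<circ> \<tau>))
    = young_sum (sum_list \<mu>) rw cl \<phi> id * young_symmetrizer \<mu> \<tau>"
proof -
  let ?m = "sum_list \<mu>"
  let ?R = "fiber_stabilizer ?m rw" and ?C = "fiber_stabilizer ?m cl"
  have support: "young_symmetrizer \<mu> \<tau> = 0" if "\<tau> \<notin> symgrp ?m" for \<tau>
    unfolding young_symmetrizer_expand[OF R C]
    using that symgrp_simps(2) fiber_stabilizer_symgrp by (intro sum.neutral ballI) fastforce
  show ?thesis
  proof (cases "\<tau> \<in> symgrp ?m")
    case False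
    then show ?thesis
      using symgrp_comp_iff[OF symgrp_simps(3)] by (simp add: support)
  next
    case True
    have "(\<Sum>s\<in>symgrp ?m. \<phi> s * young_symmetrizer \<mu> (inv_into UNIV s \<circ> \<tau>))
      = (\<Sum>s\<in>symgrp ?m. \<Sum>p\<in>?R. \<Sum>q\<in>?C.
          if inv_into UNIV s \<circ> \<tau> = p \<circ> q then \<phi> s * of_int (sign q) else 0)"
      unfolding young_symmetrizer_expand[OF R C] sum_distrib_left
      by (intro sum.cong refl) simp
    also have "\<dots> = (\<Sum>p\<in>?R. \<Sum>s\<in>symgrp ?m. \<Sum>q\<in>?C.
          if inv_into UNIV s \<circ> \<tau> = p \<circ> q then \<phi> s * of_int (sign q) else 0)"
      by (rule sum.swap)
    also have "\<dots> = (\<Sum>p\<in>?R. \<Sum>q\<in>?C. \<Sum>s\<in>symgrp ?m.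
          if inv_into UNIV s \<circ> \<tau> = p \<circ> q then \<phi> s * of_int (sign q) else 0)"
      by (intro sum.cong refl sum.swap)
    also have "\<dots> = (\<Sum>p\<in>?R. \<Sum>q\<in>?C.
        of_int (sign (inv_into UNIV q)) * \<phi> (inv_into UNIV p \<circ> \<tau> \<circ> inv_into UNIV q))"
    proof (intro sum.cong refl)
      fix p q assume p: "p \<in> ?R" and q: "q \<in> ?C"
      let ?p = "inv_into UNIV p" and ?q = "inv_into UNIV q"
      note pq = fiber_stabilizer_symgrp[OF p] fiber_stabilizer_symgrp[OF q]
      have mem: "\<tau> \<circ> (?q \<circ> ?p) \<in> symgrp ?m" "\<tau> \<circ> ?q \<in> symgrp ?m" "?p \<in> symgrp ?m"
        using True pq by (auto intro!: symgrp_simps)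
      \<comment> \<open>For given \<open>p\<close> and \<open>q\<close> exactly one group element
        \<open>s\<close> contributes, so the inner sum is a single value of
        \<open>\<phi>\<close>.\<close>
      have "inv_into UNIV s \<circ> \<tau> = p \<circ> q \<longleftrightarrow> s = \<tau> \<circ> (?q \<circ> ?p)" if s: "s \<in> symgrp ?m" for s
      proof
        assume "inv_into UNIV s \<circ> \<tau> = p \<circ> q"
        then have "\<tau> = s \<circ> (p \<circ> q)" using symgrp_comp_cancel(2)[OF s] by metis
        then show "s = \<tau> \<circ> (?q \<circ> ?p)"
          using symgrp_comp_cancel(2)[OF pq(2)] symgrp_simps(6)[OF pq(1)] by (simp add: comp_assoc)
      next
        assume "s = \<tau> \<circ> (?q \<circ> ?p)"
        then have "s \<circ> (p \<circ> q) = \<tau>"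
          using symgrp_comp_cancel(1)[OF pq(1)] symgrp_simps(5)[OF pq(2)] by (simp add: comp_assoc)
        then show "inv_into UNIV s \<circ> \<tau> = p \<circ> q"
          using symgrp_comp_cancel(1)[OF s] by metis
      qed
      then have "(\<Sum>s\<in>symgrp ?m. if inv_into UNIV s \<circ> \<tau> = p \<circ> q then \<phi> s * of_int (sign q) else 0)
        = (\<Sum>s\<in>symgrp ?m. if s = \<tau> \<circ> (?q \<circ> ?p) then \<phi> s * of_int (sign q) else 0)"
        by (intro sum.cong refl) simp
      also have "\<dots> = \<phi> (\<tau> \<circ> ?q \<circ> ?p) * of_int (sign q)"
        using mem(1) by (simp add: sum.delta symgrp_simps(7) comp_assoc)
      also have "\<phi> (\<tau> \<circ> ?q \<circ> ?p) = \<phi> (?p \<circ> (\<tau> \<circ> ?q))"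
        using cls mem unfolding class_function_def by blast
      finally show "(\<Sum>s\<in>symgrp ?m. if inv_into UNIV s \<circ> \<tau> = p \<circ> q then \<phi> s * of_int (sign q) else 0)
        = of_int (sign ?q) * \<phi> (?p \<circ> \<tau> \<circ> ?q)"
        by (simp only: comp_assoc sign_inverse[OF permutation_fiber_stabilizer[OF q]] mult.commute)
    qed
    also have "\<dots> = young_sum ?m rw cl \<phi> \<tau>"
    proof -
      have "(\<Sum>q\<in>?C. of_int (sign (inv_into UNIV q)) * \<phi> (p \<circ> \<tau> \<circ> inv_into UNIV q))
          = (\<Sum>q\<in>?C. of_int (sign q) * \<phi> (p \<circ> \<tau> \<circ> q))" for p
        by (rule sum_fiber_stabilizer_inv)
      then show ?thesis
        unfolding young_sum_def by (simp only: sum_fiber_stabilizer_inv[where f=rw and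
              h="\<lambda>p. \<Sum>q\<in>?C. of_int (sign q) * \<phi> (p \<circ> \<tau> \<circ> q)"])
    qed
    also have "\<dots> = young_sum ?m rw cl \<phi> id * young_symmetrizer \<mu> \<tau>"
      unfolding young_symmetrizer_eq_young_sum[OF R C]
      by (rule young_sum_eq_delta[OF fill]) (use True in \<open>simp add: symgrp_def\<close>)
    finally show ?thesis .
  qed
qed

text \<open>Elements of the module are left multiples of the symmetrizer. A central element passes
  the left factor and meets the symmetrizer, on which it acts by \<open>\<kappa>\<close>.\<close>

lemma specht_module_eigen:
  assumes eig: "\<And>\<tau>. (\<Sum>s\<in>symgrp (sum_list \<mu>). \<phi> s * young_symmetrizer \<mu> (inv_into UNIV s \<circ> \<tau>))
    = \<kappa> * young_symmetrizer \<mu> \<tau>"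
    and cls: "class_function (sum_list \<mu>) \<phi>" and f: "f \<in> specht_module \<mu>"
  shows "(\<Sum>s\<in>symgrp (sum_list \<mu>). \<phi> s * left_translate s f \<tau>) = \<kappa> * f \<tau>"
proof -
  let ?m = "sum_list \<mu>" and ?c = "young_symmetrizer \<mu>"
  obtain g where g: "f = conv ?m g ?c" using f by (auto simp: specht_module_def)
  have "(\<Sum>s\<in>symgrp ?m. \<phi> s * left_translate s f \<tau>)
      = (\<Sum>\<sigma>\<in>symgrp ?m. \<Sum>s\<in>symgrp ?m.
          g \<sigma> * (\<phi> s * ?c (inv_into UNIV \<sigma> \<circ> (inv_into UNIV s \<circ> \<tau>))))"
    unfolding g left_translate_def conv_def sum_distrib_left
    by (subst sum.swap) (simp add: mult_ac)
  also have "\<dots> = (\<Sum>\<sigma>\<in>symgrp ?m. g \<sigma> * (\<kappa> * ?c (inv_into UNIV \<sigma> \<circ> \<tau>)))"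
  proof (rule sum.cong[OF refl])
    fix \<sigma> assume \<sigma>: "\<sigma> \<in> symgrp ?m"
    let ?i = "inv_into UNIV \<sigma>"
    have "(\<Sum>s\<in>symgrp ?m. \<phi> s * ?c (?i \<circ> (inv_into UNIV s \<circ> \<tau>)))
        = (\<Sum>s\<in>symgrp ?m. \<phi> s * ?c (inv_into UNIV s \<circ> (?i \<circ> \<tau>)))"
    \<comment> \<open>Conjugating the summation variable by \<open>\<sigma>\<close> exchanges the
      order of the two translations and does not change the value of \<open>\<phi>\<close>.\<close>
    proof (rule sum.reindex_bij_witness[where i="\<lambda>s. \<sigma> \<circ> (s \<circ> ?i)" and j="\<lambda>s. ?i \<circ> (s \<circ> \<sigma>)"])
      fix s assume s: "s \<in> symgrp ?m"
      show "?i \<circ> (\<sigma> \<circ> (s \<circ> ?i) \<circ> \<sigma>) = s" "\<sigma> \<circ> (?i \<circ> (s \<circ> \<sigma>) \<circ> ?i) = s"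
        using symgrp_comp_cancel[OF \<sigma>] symgrp_simps(5,6)[OF \<sigma>] by (simp_all add: comp_assoc)
      show "\<sigma> \<circ> (s \<circ> ?i) \<in> symgrp ?m" "?i \<circ> (s \<circ> \<sigma>) \<in> symgrp ?m"
        using \<sigma> s by (auto intro!: symgrp_simps)
      have "\<phi> (?i \<circ> (s \<circ> \<sigma>)) = \<phi> ((s \<circ> \<sigma>) \<circ> ?i)"
        using cls \<sigma> s unfolding class_function_def by (auto intro: symgrp_simps)
      also have "(s \<circ> \<sigma>) \<circ> ?i = s" using symgrp_simps(6)[OF \<sigma>] by (simp add: comp_assoc)
      finally have "\<phi> (?i \<circ> (s \<circ> \<sigma>)) = \<phi> s" .
      moreover have "inv_into UNIV (?i \<circ> (s \<circ> \<sigma>)) = ?i \<circ> (inv_into UNIV s \<circ> \<sigma>)"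
        using symgrp_inv_comp[OF symgrp_simps(3)[OF \<sigma>] symgrp_simps(2)[OF s \<sigma>]]
          symgrp_inv_comp[OF s \<sigma>] symgrp_simps(4)[OF \<sigma>] by (simp add: comp_assoc)
      ultimately show "\<phi> (?i \<circ> (s \<circ> \<sigma>)) * ?c (inv_into UNIV (?i \<circ> (s \<circ> \<sigma>)) \<circ> (?i \<circ> \<tau>))
          = \<phi> s * ?c (?i \<circ> (inv_into UNIV s \<circ> \<tau>))"
        using symgrp_comp_cancel(2)[OF \<sigma>] by (simp add: comp_assoc)
    qed
    then show "(\<Sum>s\<in>symgrp ?m. g \<sigma> * (\<phi> s * ?c (?i \<circ> (inv_into UNIV s \<circ> \<tau>))))
        = g \<sigma> * (\<kappa> * ?c (?i \<circ> \<tau>))"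
      unfolding sum_distrib_left[symmetric] by (simp add: eig)
  qed
  also have "\<dots> = \<kappa> * f \<tau>"
    unfolding g conv_def sum_distrib_left by (simp add: mult_ac)
  finally show ?thesis .
qed

lemma left_translate_specht_module:
  assumes s: "\<sigma> \<in> symgrp (sum_list \<mu>)" and f: "f \<in> specht_module \<mu>"
  shows "left_translate \<sigma> f \<in> specht_module \<mu>"
proof -
  let ?m = "sum_list \<mu>" and ?c = "young_symmetrizer \<mu>"
  obtain g where g: "f = conv ?m g ?c" "g \<in> group_algebra ?m"
    using f by (auto simp: specht_module_def)
  have "left_translate \<sigma> f \<tau> = conv ?m (left_translate \<sigma> g) ?c \<tau>" for \<tau>
    unfolding g left_translate_def conv_def
    using s symgrp_comp_cancel[OF s]
    by (intro sum.reindex_bij_witness[where j="\<lambda>s. \<sigma> \<circ> s" and i="\<lambda>s. inv_into UNIV \<sigma> \<circ> s"])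
      (auto simp: symgrp_simps symgrp_inv_comp comp_assoc)
  moreover have "left_translate \<sigma> g \<in> group_algebra ?m"
    using g(2) symgrp_comp_iff[OF symgrp_simps(3)[OF s]]
    by (simp add: group_algebra_def left_translate_def)
  ultimately show ?thesis
    unfolding specht_module_def by blast
qed

lemma subspace_specht_module: "fun_vs.subspace (specht_module \<mu>)"
  unfolding fun_vs.subspace_def
proof (intro conjI ballI allI)
  let ?m = "sum_list \<mu>" and ?c = "young_symmetrizer \<mu>"
  have "(0::grpalg) = conv ?m 0 ?c" by (simp add: conv_def fun_eq_iff)
  moreover have "0 \<in> group_algebra ?m" by (simp add: group_algebra_def)
  ultimately show "0 \<in> specht_module \<mu>" unfolding specht_module_def by (rule image_eqI)
next
  fix f f' assume "f \<in> specht_module \<mu>" "f' \<in> specht_module \<mu>"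
  let ?m = "sum_list \<mu>" and ?c = "young_symmetrizer \<mu>"
  obtain g g' where "f = conv ?m g ?c" "g \<in> group_algebra ?m" "f' = conv ?m g' ?c" "g' \<in> group_algebra ?m"
    using \<open>f \<in> _\<close> \<open>f' \<in> _\<close> by (auto simp: specht_module_def)
  then have "f + f' = conv ?m (g + g') ?c" "g + g' \<in> group_algebra ?m"
    by (auto simp: conv_def group_algebra_def plus_fun_def distrib_right sum.distrib)
  then show "f + f' \<in> specht_module \<mu>" unfolding specht_module_def by (rule image_eqI)
next
  fix a f assume "f \<in> specht_module \<mu>"
  let ?m = "sum_list \<mu>" and ?c = "young_symmetrizer \<mu>"
  obtain g where "f = conv ?m g ?c" "g \<in> group_algebra ?m"
    using \<open>f \<in> _\<close> by (auto simp: specht_module_def)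
  then have "fscale a f = conv ?m (fscale a g) ?c" "fscale a g \<in> group_algebra ?m"
    by (auto simp: conv_def group_algebra_def fscale_def sum_distrib_left mult.assoc)
  then show "fscale a f \<in> specht_module \<mu>" unfolding specht_module_def by (rule image_eqI)
qed

text \<open>A basis exists, so the choice in \<open>trace_on\<close> is a genuine one; it depends on
  the space alone, hence one basis serves all endomorphisms.\<close>

lemma trace_on_basis:
  assumes "fun_vs.subspace W"
  obtains B where "B \<subseteq> W" "fun_vs.independent B" "fun_vs.span B = W"
    "\<And>\<phi>. trace_on W \<phi> = (\<Sum>b\<in>B. fun_vs.representation B (\<phi> b) b)"
proof -
  let ?P = "\<lambda>B. B \<subseteq> W \<and> fun_vs.independent B \<and> fun_vs.span B = W"
  obtain B0 where "B0 \<subseteq> W" "fun_vs.independent B0" "W \<subseteq> fun_vs.span B0"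
    using fun_vs.maximal_independent_subset[of W] by metis
  then have "?P B0"
    using fun_vs.span_minimal[OF _ assms] by blast
  then have "?P (SOME B. ?P B)" by (rule someI)
  then show ?thesis
    by (intro that[of "SOME B. ?P B"]) (auto simp: trace_on_def Let_def)
qed

text \<open>The sum is the trace of the operator \<open>\<phi>\<close> on the Specht module, and
  this operator is the scalar \<open>\<kappa>\<close>. So \<open>K\<close> is the dimension;
  quantifying it before \<open>\<phi>\<close> makes it the same constant for all class
  functions.\<close>

lemma sym_char_eigen:
  shows "\<exists>K. \<forall>\<phi> \<kappa>. class_function (sum_list \<mu>) \<phi> \<longrightarrow>
      (\<forall>\<tau>. (\<Sum>s\<in>symgrp (sum_list \<mu>). \<phi> s * young_symmetrizer \<mu> (inv_into UNIV s \<circ> \<tau>))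
        = \<kappa> * young_symmetrizer \<mu> \<tau>) \<longrightarrow>
      (\<Sum>\<sigma>\<in>symgrp (sum_list \<mu>). sym_char \<mu> \<sigma> * \<phi> \<sigma>) = K * \<kappa>"
proof -
  let ?G = "symgrp (sum_list \<mu>)"
  obtain B where B: "B \<subseteq> specht_module \<mu>" "fun_vs.independent B" "fun_vs.span B = specht_module \<mu>"
    and tr: "\<And>\<phi>. trace_on (specht_module \<mu>) \<phi> = (\<Sum>b\<in>B. fun_vs.representation B (\<phi> b) b)"
    by (rule trace_on_basis[OF subspace_specht_module[of \<mu>]]) (rule that)
  show ?thesis
  proof (intro exI[of _ "of_nat (card B)"] allI impI)
    fix \<phi> \<kappa> assume cls: "class_function (sum_list \<mu>) \<phi>"
      and eig: "\<forall>\<tau>. (\<Sum>s\<in>?G. \<phi> s * young_symmetrizer \<mu> (inv_into UNIV s \<circ> \<tau>))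
        = \<kappa> * young_symmetrizer \<mu> \<tau>"
    have "(\<Sum>\<sigma>\<in>?G. sym_char \<mu> \<sigma> * \<phi> \<sigma>)
        = (\<Sum>b\<in>B. \<Sum>\<sigma>\<in>?G. \<phi> \<sigma> * fun_vs.representation B (left_translate \<sigma> b) b)"
      unfolding sym_char_def tr sum_distrib_right
      by (subst sum.swap) (simp add: mult_ac)
    also have "\<dots> = (\<Sum>b\<in>B. \<kappa>)"
    proof (rule sum.cong[OF refl])
      fix b assume b: "b \<in> B"
      then have bW: "b \<in> specht_module \<mu>" using B(1) by auto
      \<comment> \<open>Coordinates with respect to \<open>B\<close> are linear on its span, so the
        translates must be known to stay in the module.\<close>
      have mem: "left_translate \<sigma> b \<in> fun_vs.span B" if "\<sigma> \<in> ?G" for \<sigma>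
        unfolding B(3) by (rule left_translate_specht_module[OF that bW])
      have "(\<Sum>\<sigma>\<in>?G. \<phi> \<sigma> * fun_vs.representation B (left_translate \<sigma> b) b)
        = (\<Sum>\<sigma>\<in>?G. fun_vs.representation B (fscale (\<phi> \<sigma>) (left_translate \<sigma> b)) b)"
        by (intro sum.cong refl) (simp add: fun_vs.representation_scale[OF B(2) mem])
      also have "\<dots> = fun_vs.representation B (\<Sum>\<sigma>\<in>?G. fscale (\<phi> \<sigma>) (left_translate \<sigma> b)) b"
        using fun_vs.representation_sum[OF B(2), of ?G "\<lambda>\<sigma>. fscale (\<phi> \<sigma>) (left_translate \<sigma> b)"]
        by (simp add: fun_vs.span_scale mem)
      also have "(\<Sum>\<sigma>\<in>?G. fscale (\<phi> \<sigma>) (left_translate \<sigma> b)) = fscale \<kappa> b"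
      proof
        have "(\<Sum>\<sigma>\<in>A. fscale (\<phi> \<sigma>) (left_translate \<sigma> b)) \<tau>
          = (\<Sum>\<sigma>\<in>A. \<phi> \<sigma> * left_translate \<sigma> b \<tau>)" for \<tau> A
          by (induction A rule: infinite_finite_induct) (simp_all add: fscale_def)
        then show "(\<Sum>\<sigma>\<in>?G. fscale (\<phi> \<sigma>) (left_translate \<sigma> b)) \<tau> = fscale \<kappa> b \<tau>" for \<tau>
          using specht_module_eigen[OF eig[rule_format] cls bW] by (simp add: fscale_def)
      qed
      also have "fun_vs.representation B (fscale \<kappa> b) b = \<kappa>"
        using fun_vs.representation_scale[OF B(2) fun_vs.span_base[OF b]]
          fun_vs.representation_basis[OF B(2) b] by simp
      finally show "(\<Sum>\<sigma>\<in>?G. \<phi> \<sigma> * fun_vs.representation B (left_translate \<sigma> b) b) = \<kappa>" .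
    qed
    finally show "(\<Sum>\<sigma>\<in>?G. sym_char \<mu> \<sigma> * \<phi> \<sigma>) = of_nat (card B) * \<kappa>" by simp
  qed
qed

section \<open>The tableau filled row by row\<close>

lemma diagram_Cons: "diagram (a # \<mu>) = Pair 0 ` {..<a} \<union> map_prod Suc id ` diagram \<mu>"
proof (intro equalityI subsetI)
  fix b assume "b \<in> diagram (a # \<mu>)"
  then obtain i j where b: "b = (i, j)" "i < Suc (length \<mu>)" "j < (a # \<mu>) ! i"
    by (auto simp: diagram_def)
  then show "b \<in> Pair 0 ` {..<a} \<union> map_prod Suc id ` diagram \<mu>"
    by (cases i) (auto simp: diagram_def map_prod_def image_iff)
qed (auto simp: diagram_def)

text \<open>The first row takes the numbers below \<open>a\<close>; the remaining rows form the
  tableau of the tail, with entries raised by \<open>a\<close> and row numbers by one.\<close>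

lemma tab_entry_bij: "bij_betw (tab_entry \<mu>) (diagram \<mu>) {..<sum_list \<mu>}"
proof (induction \<mu>)
  case Nil
  then show ?case by (simp add: diagram_def bij_betw_def)
next
  case (Cons a \<mu>)
  have 1: "bij_betw (tab_entry (a # \<mu>)) (Pair 0 ` {..<a}) {..<a}"
    by (rule bij_betwI[where g="Pair 0"]) (auto simp: tab_entry_def)
  have "bij_betw ((+) a \<circ> tab_entry \<mu>) (diagram \<mu>) {a..<a + sum_list \<mu>}"
    using Cons.IH bij_betw_add[of a "{..<sum_list \<mu>}" "{a..<a + sum_list \<mu>}"]
    by (intro bij_betw_trans[OF Cons.IH]) (simp add: lessThan_atLeast0 add.commute)
  moreover have "(+) a \<circ> tab_entry \<mu> = tab_entry (a # \<mu>) \<circ> map_prod Suc id"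
    by (auto simp: tab_entry_def)
  moreover have "inj (map_prod Suc (id :: nat \<Rightarrow> nat))"
    by (intro prod.inj_map) auto
  ultimately have 2: "bij_betw (tab_entry (a # \<mu>)) (map_prod Suc id ` diagram \<mu>) {a..<a + sum_list \<mu>}"
    by (subst bij_betw_comp_iff[where A="diagram \<mu>" and f="map_prod Suc id"])
      (auto simp: bij_betw_def intro: inj_on_subset)
  have "{..<a} \<union> {a..<a + sum_list \<mu>} = {..<sum_list (a # \<mu>)}" by auto
  moreover have "{..<a} \<inter> {a..<a + sum_list \<mu>} = {}" by auto
  ultimately show ?case
    using bij_betw_combine[OF 1 2] by (simp add: diagram_Cons)
qed

lemma card_diagram: "card (diagram \<mu>) = sum_list \<mu>"
  using bij_betw_same_card[OF tab_entry_bij] by simp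

text \<open>Reading order increases downwards and to the right, which makes the row-by-row filling
  standard.\<close>

lemma tab_entry_mono:
  assumes "i \<le> i'" "j \<le> j'"
  shows "tab_entry \<mu> (i, j) \<le> tab_entry \<mu> (i', j')"
proof -
  have "take i' \<mu> = take i \<mu> @ take (i' - i) (drop i \<mu>)"
    using assms(1) by (metis le_add_diff_inverse take_add)
  then have "sum_list (take i \<mu>) \<le> sum_list (take i' \<mu>)" by simp
  then show ?thesis using assms(2) by (simp add: tab_entry_def)
qed

lemma diagram_down_closed:
  assumes "is_partition \<mu>" "(i', j') \<in> diagram \<mu>" "i \<le> i'" "j \<le> j'"
  shows "(i, j) \<in> diagram \<mu>"
proof -
  have "\<mu> ! i' \<le> \<mu> ! i"
    using assms by (cases "i = i'") (auto simp: is_partition_def diagram_def sorted_wrt_iff_nth_less)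
  then show ?thesis using assms by (auto simp: diagram_def)
qed

text \<open>The inverse of the tableau. Beyond its entries the value is arbitrary, but permutations
  in the stabilizers fix those points.\<close>

definition entry_box :: "nat list \<Rightarrow> nat \<Rightarrow> nat \<times> nat" where
  "entry_box \<mu> = inv_into (diagram \<mu>) (tab_entry \<mu>)"

definition entry_row :: "nat list \<Rightarrow> nat \<Rightarrow> nat" where
  "entry_row \<mu> e = fst (entry_box \<mu> e)"

definition entry_col :: "nat list \<Rightarrow> nat \<Rightarrow> nat" where
  "entry_col \<mu> e = snd (entry_box \<mu> e)"

lemma entry_box_bij: "bij_betw (entry_box \<mu>) {..<sum_list \<mu>} (diagram \<mu>)"
  unfolding entry_box_def by (rule bij_betw_inv_into[OF tab_entry_bij])

lemma entry_box_eq: "entry_box \<mu> e = (entry_row \<mu> e, entry_col \<mu> e)"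
  by (simp add: entry_row_def entry_col_def)

lemma entry_box_tab_entry: "b \<in> diagram \<mu> \<Longrightarrow> entry_box \<mu> (tab_entry \<mu> b) = b"
  unfolding entry_box_def using tab_entry_bij[of \<mu>] by (simp add: bij_betw_def inv_into_f_f)

lemma tab_entry_entry_box: "e < sum_list \<mu> \<Longrightarrow> tab_entry \<mu> (entry_box \<mu> e) = e"
  unfolding entry_box_def using tab_entry_bij[of \<mu>] by (simp add: bij_betw_def f_inv_into_f)

lemma entry_box_in_diagram: "e < sum_list \<mu> \<Longrightarrow> entry_box \<mu> e \<in> diagram \<mu>"
  using bij_betwE[OF entry_box_bij] by simp

lemma tab_entry_less: "b \<in> diagram \<mu> \<Longrightarrow> tab_entry \<mu> b < sum_list \<mu>"
  using bij_betwE[OF tab_entry_bij] by simp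

lemma standard_filling_entry:
  assumes "is_partition \<mu>"
  shows "standard_filling (sum_list \<mu>) (entry_row \<mu>) (entry_col \<mu>)"
  unfolding standard_filling_def
proof (intro conjI allI impI)
  show "inj_on (\<lambda>e. (entry_row \<mu> e, entry_col \<mu> e)) {..<sum_list \<mu>}"
    using entry_box_bij[of \<mu>] by (simp add: bij_betw_def entry_box_eq[symmetric])
next
  fix e i j assume e: "e < sum_list \<mu>" and ij: "i \<le> entry_row \<mu> e" "j \<le> entry_col \<mu> e"
  have "(i, j) \<in> diagram \<mu>"
    using diagram_down_closed[OF assms _ ij] entry_box_in_diagram[OF e] by (simp add: entry_box_eq)
  then have "entry_row \<mu> (tab_entry \<mu> (i, j)) = i" "entry_col \<mu> (tab_entry \<mu> (i, j)) = j"
    by (simp_all add: entry_row_def entry_col_def entry_box_tab_entry)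
  moreover have "tab_entry \<mu> (i, j) \<le> e"
    using tab_entry_mono[OF ij, of \<mu>] tab_entry_entry_box[OF e] by (simp add: entry_box_eq)
  ultimately show "\<exists>e'\<le>e. entry_row \<mu> e' = i \<and> entry_col \<mu> e' = j" by blast
qed

lemma tab_row_eq: "tab_row \<mu> i = {e. e < sum_list \<mu> \<and> entry_row \<mu> e = i}"
proof (intro equalityI subsetI)
  fix e assume "e \<in> tab_row \<mu> i"
  then obtain j where "e = tab_entry \<mu> (i, j)" "(i, j) \<in> diagram \<mu>" by (auto simp: tab_row_def)
  then show "e \<in> {e. e < sum_list \<mu> \<and> entry_row \<mu> e = i}"
    by (simp add: entry_row_def entry_box_tab_entry tab_entry_less)
next
  fix e assume "e \<in> {e. e < sum_list \<mu> \<and> entry_row \<mu> e = i}"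
  then show "e \<in> tab_row \<mu> i"
    using tab_entry_entry_box[of e \<mu>] entry_box_in_diagram[of e \<mu>]
    by (auto simp: tab_row_def entry_box_eq intro!: exI[of _ "entry_col \<mu> e"])
qed

lemma tab_col_eq: "tab_col \<mu> j = {e. e < sum_list \<mu> \<and> entry_col \<mu> e = j}"
proof (intro equalityI subsetI)
  fix e assume "e \<in> tab_col \<mu> j"
  then obtain i where "e = tab_entry \<mu> (i, j)" "(i, j) \<in> diagram \<mu>" by (auto simp: tab_col_def)
  then show "e \<in> {e. e < sum_list \<mu> \<and> entry_col \<mu> e = j}"
    by (simp add: entry_col_def entry_box_tab_entry tab_entry_less)
next
  fix e assume "e \<in> {e. e < sum_list \<mu> \<and> entry_col \<mu> e = j}"
  then show "e \<in> tab_col \<mu> j"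
    using tab_entry_entry_box[of e \<mu>] entry_box_in_diagram[of e \<mu>]
    by (auto simp: tab_col_def entry_box_eq intro!: exI[of _ "entry_row \<mu> e"])
qed

text \<open>An injective map of a finite block into itself is onto, so preserving labels already
  gives setwise invariance of every block.\<close>

lemma fiber_stabilizer_eq:
  "{\<sigma> \<in> symgrp m. \<forall>i. \<sigma> ` {e. e < m \<and> f e = i} = {e. e < m \<and> f e = i}} = fiber_stabilizer m f"
proof (intro equalityI subsetI)
  fix \<sigma> assume "\<sigma> \<in> {\<sigma> \<in> symgrp m. \<forall>i. \<sigma> ` {e. e < m \<and> f e = i} = {e. e < m \<and> f e = i}}"
  then have s: "\<sigma> permutes {..<m}"
    and inv: "\<And>i. \<sigma> ` {e. e < m \<and> f e = i} = {e. e < m \<and> f e = i}" by (auto simp: symgrp_def)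
  have "f (\<sigma> e) = f e" for e
  proof (cases "e < m")
    case True
    then have "\<sigma> e \<in> \<sigma> ` {e'. e' < m \<and> f e' = f e}" by blast
    then show ?thesis unfolding inv by simp
  next
    case False
    then show ?thesis using permutes_not_in[OF s] by simp
  qed
  then show "\<sigma> \<in> fiber_stabilizer m f" using s by (simp add: fiber_stabilizer_def)
next
  fix \<sigma> assume s: "\<sigma> \<in> fiber_stabilizer m f"
  have p: "\<sigma> permutes {..<m}" by (rule fiber_stabilizer_permutes[OF s])
  have "\<sigma> ` {e. e < m \<and> f e = i} = {e. e < m \<and> f e = i}" for i
  proof (rule endo_inj_surj)
    show "\<sigma> ` {e. e < m \<and> f e = i} \<subseteq> {e. e < m \<and> f e = i}"
      using s permutes_in_image[OF p] by (auto simp: fiber_stabilizer_def)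
    show "inj_on \<sigma> {e. e < m \<and> f e = i}"
      using permutes_inj[OF p] by (rule inj_on_subset) simp
  qed simp
  then show "\<sigma> \<in> {\<sigma> \<in> symgrp m. \<forall>i. \<sigma> ` {e. e < m \<and> f e = i} = {e. e < m \<and> f e = i}}"
    using fiber_stabilizer_symgrp[OF s] by blast
qed

lemma row_stabilizer_eq: "row_stabilizer \<mu> = fiber_stabilizer (sum_list \<mu>) (entry_row \<mu>)"
  unfolding row_stabilizer_def tab_row_eq by (rule fiber_stabilizer_eq)

lemma col_stabilizer_eq: "col_stabilizer \<mu> = fiber_stabilizer (sum_list \<mu>) (entry_col \<mu>)"
  unfolding col_stabilizer_def tab_col_eq by (rule fiber_stabilizer_eq)

text \<open>The content formula: for the class function \<open>x ^ num_cycles\<close> the eigenvalue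
  on the Specht module is the product over the contents. The constant is chosen before
  \<open>x\<close>, so the identity is one of polynomials in \<open>x\<close>.\<close>

lemma sum_sym_char_num_cycles:
  assumes "is_partition \<mu>"
  obtains K where "\<And>x. (\<Sum>\<sigma>\<in>symgrp (sum_list \<mu>). sym_char \<mu> \<sigma> * x ^ num_cycles (sum_list \<mu>) \<sigma>)
    = K * (\<Prod>b\<in>diagram \<mu>. x + of_int (box_content b))"
proof -
  note fill = standard_filling_entry[OF assms]
  obtain K where K: "\<forall>\<phi> \<kappa>. class_function (sum_list \<mu>) \<phi> \<longrightarrow>
      (\<forall>\<tau>. (\<Sum>s\<in>symgrp (sum_list \<mu>). \<phi> s * young_symmetrizer \<mu> (inv_into UNIV s \<circ> \<tau>))
        = \<kappa> * young_symmetrizer \<mu> \<tau>) \<longrightarrow>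
      (\<Sum>\<sigma>\<in>symgrp (sum_list \<mu>). sym_char \<mu> \<sigma> * \<phi> \<sigma>) = K * \<kappa>"
    using sym_char_eigen[of \<mu>] by (elim exE) (rule that)
  show ?thesis
  proof (rule that[of K])
    fix x :: complex
    have "(\<Sum>\<sigma>\<in>symgrp (sum_list \<mu>). sym_char \<mu> \<sigma> * x ^ num_cycles (sum_list \<mu>) \<sigma>)
      = K * young_sum (sum_list \<mu>) (entry_row \<mu>) (entry_col \<mu>)
          (\<lambda>\<sigma>. x ^ num_cycles (sum_list \<mu>) \<sigma>) id"
      by (rule K[rule_format, OF class_function_num_cycles young_symmetrizer_eigen[OF
            row_stabilizer_eq col_stabilizer_eq fill class_function_num_cycles]])
    also have "young_sum (sum_list \<mu>) (entry_row \<mu>) (entry_col \<mu>)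
          (\<lambda>\<sigma>. x ^ num_cycles (sum_list \<mu>) \<sigma>) id
      = (\<Prod>e<sum_list \<mu>. x + of_int (box_content (entry_box \<mu> e)))"
      unfolding young_sum_num_cycles[OF fill]
      by (intro prod.cong refl) (simp add: box_content_def entry_row_def entry_col_def)
    also have "\<dots> = (\<Prod>b\<in>diagram \<mu>. x + of_int (box_content b))"
      by (rule prod.reindex_bij_betw[OF entry_box_bij])
    finally show "(\<Sum>\<sigma>\<in>symgrp (sum_list \<mu>). sym_char \<mu> \<sigma> * x ^ num_cycles (sum_list \<mu>) \<sigma>)
      = K * (\<Prod>b\<in>diagram \<mu>. x + of_int (box_content b))" .
  qed
qed

section \<open>Specializing the power sums\<close>

definition monomial_eval :: "(nat \<times> complex \<Rightarrow> complex) \<Rightarrow> ((nat \<times> complex) \<Rightarrow>\<^sub>0 nat) \<Rightarrow> complex" where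
  "monomial_eval v m = (\<Prod>x\<in>Poly_Mapping.keys m. v x ^ Poly_Mapping.lookup m x)"

definition poly_eval :: "(nat \<times> complex \<Rightarrow> complex) \<Rightarrow> ppoly \<Rightarrow> complex" where
  "poly_eval v P = (\<Sum>m\<in>Poly_Mapping.keys P. Poly_Mapping.lookup P m * monomial_eval v m)"

lemma monomial_eval_superset:
  assumes "finite S" "Poly_Mapping.keys m \<subseteq> S"
  shows "monomial_eval v m = (\<Prod>x\<in>S. v x ^ Poly_Mapping.lookup m x)"
  unfolding monomial_eval_def using assms
  by (intro prod.mono_neutral_left) (auto simp: in_keys_iff)

lemma monomial_eval_add: "monomial_eval v (m + m') = monomial_eval v m * monomial_eval v m'"
proof -
  let ?S = "Poly_Mapping.keys m \<union> Poly_Mapping.keys m'"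
  have "monomial_eval v (m + m') = (\<Prod>x\<in>?S. v x ^ Poly_Mapping.lookup (m + m') x)"
    by (rule monomial_eval_superset) (use Poly_Mapping.keys_add[of m m'] in auto)
  also have "\<dots> = (\<Prod>x\<in>?S. v x ^ Poly_Mapping.lookup m x) * (\<Prod>x\<in>?S. v x ^ Poly_Mapping.lookup m' x)"
    by (simp add: lookup_add power_add prod.distrib)
  also have "\<dots> = monomial_eval v m * monomial_eval v m'"
    using monomial_eval_superset[of ?S m v] monomial_eval_superset[of ?S m' v] by simp
  finally show ?thesis .
qed

text \<open>Cancellation may remove keys from a sum, so additivity is checked over a common finite
  set of monomials.\<close>

lemma poly_eval_superset:
  assumes "finite S" "Poly_Mapping.keys P \<subseteq> S"
  shows "poly_eval v P = (\<Sum>m\<in>S. Poly_Mapping.lookup P m * monomial_eval v m)"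
  unfolding poly_eval_def using assms
  by (intro sum.mono_neutral_left) (auto simp: in_keys_iff)

lemma poly_eval_add: "poly_eval v (P + Q) = poly_eval v P + poly_eval v Q"
proof -
  let ?S = "Poly_Mapping.keys P \<union> Poly_Mapping.keys Q"
  have "poly_eval v (P + Q) = (\<Sum>m\<in>?S. Poly_Mapping.lookup (P + Q) m * monomial_eval v m)"
    by (rule poly_eval_superset) (use Poly_Mapping.keys_add[of P Q] in auto)
  also have "\<dots> = (\<Sum>m\<in>?S. Poly_Mapping.lookup P m * monomial_eval v m)
      + (\<Sum>m\<in>?S. Poly_Mapping.lookup Q m * monomial_eval v m)"
    by (simp add: lookup_add distrib_right sum.distrib)
  also have "\<dots> = poly_eval v P + poly_eval v Q"
    using poly_eval_superset[of ?S P v] poly_eval_superset[of ?S Q v] by simp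
  finally show ?thesis .
qed

lemma poly_eval_zero: "poly_eval v 0 = 0"
  by (simp add: poly_eval_def)

lemma poly_eval_sum: "poly_eval v (\<Sum>i\<in>A. f i) = (\<Sum>i\<in>A. poly_eval v (f i))"
  by (induction A rule: infinite_finite_induct) (simp_all add: poly_eval_zero poly_eval_add)

lemma poly_eval_single: "poly_eval v (Poly_Mapping.single m a) = a * monomial_eval v m"
  by (simp add: poly_eval_superset[where S="{m}"])

text \<open>Reduces multiplicativity of the evaluation to products of single terms.\<close>

lemma sum_singles: "(\<Sum>m\<in>Poly_Mapping.keys P. Poly_Mapping.single m (Poly_Mapping.lookup P m)) = P"
proof (rule poly_mapping_eqI)
  fix k
  have "Poly_Mapping.lookup (\<Sum>m\<in>Poly_Mapping.keys P. Poly_Mapping.single m (Poly_Mapping.lookup P m)) k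
    = (\<Sum>m\<in>Poly_Mapping.keys P. if m = k then Poly_Mapping.lookup P m else 0)"
    by (simp add: lookup_sum lookup_single when_def)
  also have "\<dots> = Poly_Mapping.lookup P k"
    by (simp add: sum.delta in_keys_iff)
  finally show "Poly_Mapping.lookup (\<Sum>m\<in>Poly_Mapping.keys P.
    Poly_Mapping.single m (Poly_Mapping.lookup P m)) k = Poly_Mapping.lookup P k" .
qed

lemma poly_eval_mult: "poly_eval v (P * Q) = poly_eval v P * poly_eval v Q"
proof -
  let ?P = "\<lambda>m. Poly_Mapping.single m (Poly_Mapping.lookup P m)"
    and ?Q = "\<lambda>m. Poly_Mapping.single m (Poly_Mapping.lookup Q m)"
  have "poly_eval v (P * Q)
      = poly_eval v ((\<Sum>m\<in>Poly_Mapping.keys P. ?P m) * (\<Sum>m\<in>Poly_Mapping.keys Q. ?Q m))"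
    by (simp only: sum_singles)
  also have "\<dots> = (\<Sum>m\<in>Poly_Mapping.keys P. \<Sum>m'\<in>Poly_Mapping.keys Q.
      (Poly_Mapping.lookup P m * monomial_eval v m) * (Poly_Mapping.lookup Q m' * monomial_eval v m'))"
    by (simp add: sum_product poly_eval_sum mult_single poly_eval_single monomial_eval_add mult_ac)
  also have "\<dots> = poly_eval v P * poly_eval v Q"
    by (simp add: poly_eval_def sum_product)
  finally show ?thesis .
qed

lemma poly_eval_pconst: "poly_eval v (pconst a) = a"
  by (simp add: pconst_def poly_eval_single monomial_eval_def)

lemma poly_eval_pvar: "poly_eval v (pvar d c) = v (d, c)"
  by (simp add: pvar_def poly_eval_single monomial_eval_def)

lemma poly_eval_one: "poly_eval v 1 = 1"
  using poly_eval_pconst[of v 1] by (simp add: pconst_def)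

lemma poly_eval_prod: "poly_eval v (\<Prod>i\<in>A. f i) = (\<Prod>i\<in>A. poly_eval v (f i))"
  by (induction A rule: infinite_finite_induct) (simp_all add: poly_eval_one poly_eval_mult)

text \<open>Multiplication by the primitive root \<open>\<zeta>\<close> permutes the roots of unity,
  so the sum equals \<open>\<zeta> ^ k\<close> times itself, and \<open>\<zeta> ^ k\<close> differs
  from 1 for \<open>0 < k < r\<close>.\<close>

lemma sum_roots_of_unity_power:
  assumes "k < r"
  shows "(\<Sum>c\<in>roots_of_unity r. c ^ k) = (if k = 0 then of_nat r else 0)"
proof (cases "k = 0")
  case True
  then show ?thesis
    using assms by (simp add: roots_of_unity_def card_roots_unity_eq)
next
  case False
  define \<zeta> where "\<zeta> = cis (2 * pi / real r)"
  have zr: "\<zeta> ^ r = 1" using assms by (simp add: \<zeta>_def DeMoivre)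
  have z0: "\<zeta> \<noteq> 0" by (simp add: \<zeta>_def)
  have zk: "\<zeta> ^ k \<noteq> 1"
  proof
    assume "\<zeta> ^ k = 1"
    then have eq: "cis (2 * pi * real k / real r) = cis (2 * pi * real 0 / real r)"
      by (simp add: \<zeta>_def DeMoivre mult_ac)
    have inj: "inj_on (\<lambda>k. cis (2 * pi * real k / real r)) {..<r}"
      using bij_betw_roots_unity[of r] assms by (simp add: bij_betw_def)
    show False using inj_onD[OF inj, of k 0] eq False assms by simp
  qed
  have "(\<Sum>c\<in>roots_of_unity r. c ^ k) = (\<Sum>c\<in>roots_of_unity r. (\<zeta> * c) ^ k)"
    by (rule sum.reindex_bij_witness[where i="\<lambda>c. \<zeta> * c" and j="\<lambda>c. inverse \<zeta> * c"])
      (use zr z0 in \<open>auto simp: roots_of_unity_def power_mult_distrib power_inverse field_simps\<close>)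
  also have "\<dots> = \<zeta> ^ k * (\<Sum>c\<in>roots_of_unity r. c ^ k)"
    by (simp add: power_mult_distrib sum_distrib_left)
  finally show ?thesis using zk False by (metis mult_cancel_right1)
qed

definition fixed_point_spec :: "complex \<Rightarrow> nat \<times> complex \<Rightarrow> complex" where
  "fixed_point_spec t dc = (if snd dc = 1 then t else 1)"

lemma poly_eval_power_sum:
  assumes "k < r"
  shows "poly_eval (fixed_point_spec t) (power_sum r d k)
    = (t - 1 + (if k = 0 then of_nat r else 0)) / of_nat r"
proof -
  have fin: "finite (roots_of_unity r)"
    unfolding roots_of_unity_def using assms by (intro finite_roots_unity) simp
  \<comment> \<open>The specialized value is 1 plus a correction at \<open>c = 1\<close>. The first
    part is a character sum, the second contributes \<open>t - 1\<close> for every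
    \<open>k\<close>.\<close>
  have "(\<Sum>c\<in>roots_of_unity r. c ^ k * fixed_point_spec t (d, c))
      = (\<Sum>c\<in>roots_of_unity r. c ^ k + (if c = 1 then t - 1 else 0))"
    by (intro sum.cong refl) (simp add: fixed_point_spec_def)
  also have "\<dots> = (if k = 0 then of_nat r else 0) + (t - 1)"
    using fin by (simp add: sum.distrib sum_roots_of_unity_power[OF assms] sum.delta)
      (simp add: roots_of_unity_def)
  finally show ?thesis
    by (simp add: power_sum_def poly_eval_mult poly_eval_sum poly_eval_pconst poly_eval_pvar)
qed

lemma poly_eval_schur:
  assumes "k < r"
  shows "poly_eval (fixed_point_spec t) (schur r k \<mu>) = 1 / fact (sum_list \<mu>) *
    (\<Sum>\<sigma>\<in>symgrp (sum_list \<mu>). sym_char \<mu> \<sigma> *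
      ((t - 1 + (if k = 0 then of_nat r else 0)) / of_nat r) ^ num_cycles (sum_list \<mu>) \<sigma>)"
  by (simp add: schur_def poly_eval_mult poly_eval_sum poly_eval_prod poly_eval_pconst
      poly_eval_power_sum[OF assms] num_cycles_def)

lemma poly_eval_cycle_type_monomial:
  "poly_eval (fixed_point_spec t) (cycle_type_monomial n g)
    = t ^ card {C \<in> cycle_sets n (perm_of n g). cycle_product n g C = 1}"
proof -
  have "finite (cycle_sets n (perm_of n g))" by (simp add: cycle_sets_def)
  then show ?thesis
    by (simp add: cycle_type_monomial_def poly_eval_prod poly_eval_pvar fixed_point_spec_def
        prod.If_cases Int_def)
qed

section \<open>Fixed spaces of monomial matrices\<close>

text \<open>The length \<open>N\<close> is the time of first return to \<open>x\<close>.\<close>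

lemma orbit_enumeration:
  assumes p: "\<pi> permutes {..<n::nat}"
  obtains N where "N > 0" "(\<pi> ^^ N) x = x" "bij_betw (\<lambda>i. (\<pi> ^^ i) x) {..<N} (orbit \<pi> x)"
proof (rule that[of "funpow_dist1 \<pi> x x"])
  have x: "x \<in> orbit \<pi> x" by (rule self_in_orbit[OF p])
  show "(\<pi> ^^ funpow_dist1 \<pi> x x) x = x" by (rule funpow_dist1_prop[OF x])
  show "bij_betw (\<lambda>i. (\<pi> ^^ i) x) {..<funpow_dist1 \<pi> x x} (orbit \<pi> x)"
    unfolding bij_betw_def lessThan_atLeast0
    using inj_on_funpow_dist1[OF x] orbit_conv_funpow_dist1[OF x] by simp
qed simp

text \<open>Multiplying the factors \<open>a\<close> along the cycle from \<open>x\<close> defines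
  \<open>f\<close>; the recursion closes up after one turn because the total product is 1.\<close>

lemma cocycle_exists:
  fixes a :: "nat \<Rightarrow> complex"
  assumes p: "\<pi> permutes {..<n}" and a: "(\<Prod>j\<in>orbit \<pi> x. a j) = 1"
  shows "\<exists>f. f x = 1 \<and> (\<forall>y\<in>orbit \<pi> x. f (\<pi> y) = a y * f y)"
proof -
  obtain N where N: "N > 0" "(\<pi> ^^ N) x = x"
    and bij: "bij_betw (\<lambda>i. (\<pi> ^^ i) x) {..<N} (orbit \<pi> x)"
    by (rule orbit_enumeration[OF p])
  define ind where "ind = inv_into {..<N} (\<lambda>i. (\<pi> ^^ i) x)"
  have ind: "ind ((\<pi> ^^ i) x) = i" if "i < N" for i
    unfolding ind_def using bij_betw_inv_into_left[OF bij] that by simp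
  define f where "f y = (\<Prod>i<ind y. a ((\<pi> ^^ i) x))" for y
  have "f x = 1" using ind[of 0] N by (simp add: f_def)
  moreover have "f (\<pi> y) = a y * f y" if "y \<in> orbit \<pi> x" for y
  proof -
    have "y \<in> (\<lambda>i. (\<pi> ^^ i) x) ` {..<N}"
      using that bij by (simp add: bij_betw_def)
    then obtain i where i: "i < N" "y = (\<pi> ^^ i) x" by auto
    show ?thesis
    proof (cases "Suc i < N")
      case True
      then show ?thesis using ind[OF True] ind[OF i(1)] i(2) by (simp add: f_def)
    next
      \<comment> \<open>Here \<open>y\<close> is the last point and its image is \<open>x\<close>
        again: the accumulated product is the full product, which has to agree with
        \<open>f x = 1\<close>.\<close>
      case False
      then have Ni: "N = Suc i" using i by simp
      have "(\<Prod>i<N. a ((\<pi> ^^ i) x)) = 1"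
        using prod.reindex_bij_betw[OF bij, of a] a by simp
      then show ?thesis
        using ind[OF i(1)] ind[OF N(1)] N(2) i(2) by (simp add: f_def Ni mult.commute)
    qed
  qed
  ultimately show ?thesis by blast
qed

text \<open>One turn around the cycle multiplies \<open>v x\<close> by the total product, yet
  returns to the same value.\<close>

lemma cocycle_zero:
  fixes a v :: "nat \<Rightarrow> complex"
  assumes p: "\<pi> permutes {..<n}" and a: "(\<Prod>j\<in>orbit \<pi> x. a j) \<noteq> 1"
    and v: "\<And>y. y \<in> orbit \<pi> x \<Longrightarrow> v (\<pi> y) = a y * v y"
  shows "v x = 0"
proof -
  obtain N where N: "N > 0" "(\<pi> ^^ N) x = x"
    and bij: "bij_betw (\<lambda>i. (\<pi> ^^ i) x) {..<N} (orbit \<pi> x)"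
    by (rule orbit_enumeration[OF p])
  have x: "x \<in> orbit \<pi> x" by (rule self_in_orbit[OF p])
  have "v ((\<pi> ^^ i) x) = (\<Prod>j<i. a ((\<pi> ^^ j) x)) * v x" for i
  proof (induction i)
    case (Suc i)
    have "(\<pi> ^^ i) x \<in> orbit \<pi> x" using funpow_in_orbit[OF x] .
    then show ?case using Suc v by (simp add: mult_ac)
  qed simp
  from this[of N] have "v x = (\<Prod>j\<in>orbit \<pi> x. a j) * v x"
    using N prod.reindex_bij_betw[OF bij, of a] by simp
  then show ?thesis using a by (metis mult_cancel_right1)
qed

text \<open>The recursion determines a solution from its value at a single point of the
  cycle.\<close>

lemma cocycle_unique:
  fixes a v f :: "nat \<Rightarrow> complex"
  assumes p: "\<pi> permutes {..<n}" and f: "f x = 1" "\<And>y. y \<in> orbit \<pi> x \<Longrightarrow> f (\<pi> y) = a y * f y"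
    and v: "\<And>y. y \<in> orbit \<pi> x \<Longrightarrow> v (\<pi> y) = a y * v y" and y: "y \<in> orbit \<pi> x"
  shows "v y = f y * v x"
  using y
proof induct
  case base
  then show ?case using self_in_orbit[OF p, of x] f v by simp
next
  case (step y)
  then show ?case using f v by (simp add: mult_ac)
qed

section \<open>Fixed vectors as solutions of the recursions\<close>

lemma grn_carrier: "g \<in> grn r n \<Longrightarrow> g \<in> carrier_mat n n"
  by (simp add: grn_def)

lemma perm_of_nonzero:
  assumes "g \<in> grn r n" "j < n"
  shows "perm_of n g j < n" "g $$ (perm_of n g j, j) \<noteq> 0"
    "\<And>i. i < n \<Longrightarrow> g $$ (i, j) \<noteq> 0 \<Longrightarrow> i = perm_of n g j"
proof -
  have "\<exists>!i. i < n \<and> g $$ (i, j) \<noteq> 0" using assms by (simp add: grn_def)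
  from theI'[OF this] this
  show "perm_of n g j < n" "g $$ (perm_of n g j, j) \<noteq> 0"
    "\<And>i. i < n \<Longrightarrow> g $$ (i, j) \<noteq> 0 \<Longrightarrow> i = perm_of n g j"
    using assms(2) by (auto simp: perm_of_def)
qed

lemma perm_of_permutes:
  assumes g: "g \<in> grn r n"
  shows "perm_of n g permutes {..<n}"
proof -
  have "inj_on (perm_of n g) {..<n}"
  proof (rule inj_onI)
    fix j j' assume j: "j \<in> {..<n}" "j' \<in> {..<n}" "perm_of n g j = perm_of n g j'"
    have "\<exists>!k. k < n \<and> g $$ (perm_of n g j, k) \<noteq> 0"
      using g perm_of_nonzero(1)[OF g, of j] j by (simp add: grn_def)
    then show "j = j'"
      using j perm_of_nonzero(2)[OF g, of j] perm_of_nonzero(2)[OF g, of j'] by auto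
  qed
  moreover have "perm_of n g ` {..<n} \<subseteq> {..<n}" using perm_of_nonzero(1)[OF g] by auto
  ultimately have "bij_betw (perm_of n g) {..<n} {..<n}"
    by (simp add: bij_betw_def endo_inj_surj)
  then show ?thesis by (rule bij_imp_permutes) (simp add: perm_of_def)
qed

lemma mult_mat_vec_perm_of:
  assumes g: "g \<in> grn r n" and v: "v \<in> carrier_vec n" and j: "j < n"
  shows "(g *\<^sub>v v) $ (perm_of n g j) = g $$ (perm_of n g j, j) * v $ j"
proof -
  let ?i = "perm_of n g j"
  have i: "?i < n" by (rule perm_of_nonzero(1)[OF g j])
  have "(g *\<^sub>v v) $ ?i = (\<Sum>k = 0..<n. g $$ (?i, k) * v $ k)"
    using i v grn_carrier[OF g] by (auto simp: scalar_prod_def intro!: sum.cong)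
  also have "\<dots> = (\<Sum>k = 0..<n. if k = j then g $$ (?i, j) * v $ j else 0)"
  proof (intro sum.cong refl)
    fix k assume k: "k \<in> {0..<n}"
    have "g $$ (?i, k) = 0" if "k \<noteq> j"
    proof (rule ccontr)
      assume "g $$ (?i, k) \<noteq> 0"
      then have "?i = perm_of n g k" using perm_of_nonzero(3)[OF g, of k ?i] k i by simp
      then show False using that permutes_inj[OF perm_of_permutes[OF g]] by (auto dest: injD)
    qed
    then show "g $$ (?i, k) * v $ k = (if k = j then g $$ (?i, j) * v $ j else 0)" by auto
  qed
  also have "\<dots> = g $$ (?i, j) * v $ j" using j by simp
  finally show ?thesis .
qed

text \<open>Since \<open>perm_of n g\<close> is onto, comparing coordinates at its values loses
  nothing. The equation \<open>g v = v\<close> becomes one recursion per cycle, with the nonzero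
  matrix entries as factors.\<close>

lemma fixed_space_iff:
  assumes g: "g \<in> grn r n"
  shows "v \<in> fixed_space n g \<longleftrightarrow> v \<in> carrier_vec n \<and>
    (\<forall>j<n. v $ (perm_of n g j) = g $$ (perm_of n g j, j) * v $ j)"
proof -
  have "g *\<^sub>v v = v \<longleftrightarrow> (\<forall>j<n. v $ (perm_of n g j) = g $$ (perm_of n g j, j) * v $ j)"
    if v: "v \<in> carrier_vec n"
  proof
    assume "g *\<^sub>v v = v"
    then show "\<forall>j<n. v $ (perm_of n g j) = g $$ (perm_of n g j, j) * v $ j"
      using mult_mat_vec_perm_of[OF g v] by metis
  next
    assume *: "\<forall>j<n. v $ (perm_of n g j) = g $$ (perm_of n g j, j) * v $ j"
    show "g *\<^sub>v v = v"
    proof (rule eq_vecI)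
      fix i assume "i < dim_vec v"
      then have "i \<in> perm_of n g ` {..<n}"
        using v permutes_image[OF perm_of_permutes[OF g]] by auto
      then show "(g *\<^sub>v v) $ i = v $ i" using mult_mat_vec_perm_of[OF g v] * by auto
    qed (use v grn_carrier[OF g] in auto)
  qed
  then show ?thesis by (auto simp: fixed_space_def)
qed

lemma vectorspace_fixed_space:
  assumes g: "g \<in> carrier_mat n n"
  shows "vectorspace class_ring ((module_vec TYPE(complex) n)\<lparr>carrier := fixed_space n g\<rparr>)"
proof -
  interpret V: vec_space "TYPE(complex)" n .
  have "submodule class_ring (fixed_space n g) (module_vec TYPE(complex) n)"
  proof (rule submodule.intro)
    show "module class_ring (module_vec TYPE(complex) n)" by (rule vec_module)
    have zero: "g *\<^sub>v 0\<^sub>v n = 0\<^sub>v n"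
      using g by (intro eq_vecI) auto
    show "fixed_space n g \<subseteq> carrier (module_vec TYPE(complex) n)"
      by (auto simp: fixed_space_def module_vec_simps)
    show "\<zero>\<^bsub>module_vec TYPE(complex) n\<^esub> \<in> fixed_space n g"
      using zero by (simp add: fixed_space_def module_vec_simps)
    show "v \<oplus>\<^bsub>module_vec TYPE(complex) n\<^esub> w \<in> fixed_space n g"
      if "v \<in> fixed_space n g" "w \<in> fixed_space n g" for v w
      using that g by (auto simp: fixed_space_def module_vec_simps mult_add_distrib_mat_vec)
    show "c \<odot>\<^bsub>module_vec TYPE(complex) n\<^esub> v \<in> fixed_space n g"
      if "v \<in> fixed_space n g" for c v
      using that g by (auto simp: fixed_space_def module_vec_simps mult_mat_vec)
  qed
  then show ?thesis
    using V.subspace_is_vs vec_vs by (metis VectorSpace.subspace.intro)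
qed

text \<open>For a cycle with product 1 the fixed vectors supported on it form a line; on any other cycle
  a fixed vector vanishes. Choosing a point on each cycle with product 1 therefore identifies the
  fixed space with a coordinate space.\<close>

lemma fixed_dim_eq:
  assumes g: "g \<in> grn r n"
  shows "fixed_dim n g = card {C \<in> cycle_sets n (perm_of n g). cycle_product n g C = 1}"
proof -
  define \<pi> where "\<pi> = perm_of n g"
  define a where "a j = g $$ (\<pi> j, j)" for j
  define G where "G = {C \<in> cycle_sets n \<pi>. (\<Prod>j\<in>C. a j) = 1}"
  define k where "k = card G"
  have p: "\<pi> permutes {..<n}" unfolding \<pi>_def by (rule perm_of_permutes[OF g])
  have p_less: "\<pi> y < n \<longleftrightarrow> y < n" for y using permutes_in_image[OF p, of y] by simp
  have "finite G" by (simp add: G_def cycle_sets_def)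
  then obtain cyc where cyc: "bij_betw cyc {0..<k} G"
    unfolding k_def using ex_bij_betw_nat_finite by blast
  have "\<exists>x. x < n \<and> cyc i = orbit \<pi> x" if "i < k" for i
  proof -
    have "cyc i \<in> G" using bij_betwE[OF cyc] that by simp
    then show ?thesis by (auto simp: G_def cycle_sets_def)
  qed
  then obtain x where x: "\<And>i. i < k \<Longrightarrow> x i < n \<and> cyc i = orbit \<pi> (x i)" by metis
  have "\<exists>f. f (x i) = 1 \<and> (\<forall>y\<in>orbit \<pi> (x i). f (\<pi> y) = a y * f y)" if i: "i < k" for i
  proof (rule cocycle_exists[OF p])
    have "cyc i \<in> G" using bij_betwE[OF cyc] i by simp
    then show "(\<Prod>j\<in>orbit \<pi> (x i). a j) = 1" using x[OF i] by (simp add: G_def)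
  qed
  then obtain f where f: "\<And>i. i < k \<Longrightarrow> f i (x i) = 1"
      "\<And>i y. i < k \<Longrightarrow> y \<in> orbit \<pi> (x i) \<Longrightarrow> f i (\<pi> y) = a y * f i y"
    by metis
  have same: "i = i'" if "i < k" "i' < k" "y \<in> cyc i" "y \<in> cyc i'" for i i' y
  proof -
    have "cyc i = cyc i'" using that x orbit_eq[OF p] by metis
    then show ?thesis using cyc that by (auto simp: bij_betw_def dest: inj_onD)
  qed
  have step: "\<pi> y \<in> cyc i \<longleftrightarrow> y \<in> cyc i" if "i < k" for i y
  proof -
    have "orbit \<pi> (\<pi> y) = orbit \<pi> y" by (rule orbit_eq[OF p]) (rule orbit.base)
    then show ?thesis using x[OF that] orbit_eq[OF p] self_in_orbit[OF p] by metis
  qed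
  \<comment> \<open>Extends values at the chosen points to a fixed vector. The cycles are disjoint,
    so at most one summand survives, and the form as a sum keeps linearity visible.\<close>
  define T where "T c = vec n (\<lambda>y. \<Sum>i<k. if y \<in> cyc i then c $ i * f i y else 0)"
    for c :: "complex vec"
  have T_at: "T c $ y = c $ i * f i y" if "i < k" "y < n" "y \<in> cyc i" for c i y
  proof -
    have "T c $ y = (\<Sum>i'<k. if y \<in> cyc i' then c $ i' * f i' y else 0)"
      using that by (simp add: T_def)
    also have "\<dots> = (\<Sum>i'<k. if i' = i then c $ i * f i y else 0)"
    proof (intro sum.cong refl)
      fix i' assume "i' \<in> {..<k}"
      then have "y \<in> cyc i' \<longleftrightarrow> i' = i" using that same by blast
      then show "(if y \<in> cyc i' then c $ i' * f i' y else 0)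
          = (if i' = i then c $ i * f i y else 0)" by simp
    qed
    finally have "T c $ y = (\<Sum>i'<k. if i' = i then c $ i * f i y else 0)" .
    then show ?thesis using that by simp
  qed
  have T_out: "T c $ y = 0" if "y < n" "\<And>i. i < k \<Longrightarrow> y \<notin> cyc i" for c y
    unfolding T_def using that by simp
  have T_fixed: "T c \<in> fixed_space n g" for c
    unfolding fixed_space_iff[OF g] \<pi>_def[symmetric] a_def[symmetric]
  proof (intro conjI allI impI)
    show "T c \<in> carrier_vec n" by (simp add: T_def)
    fix y assume y: "y < n"
    show "T c $ \<pi> y = a y * T c $ y"
    proof (cases "\<exists>i<k. y \<in> cyc i")
      case True
      then obtain i where i: "i < k" "y \<in> cyc i" by auto
      then show ?thesis
        using T_at[of i y c] T_at[of i "\<pi> y" c] y step x f(2)[of i y] by (simp add: p_less)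
    next
      case False
      then show ?thesis using T_out[of y c] T_out[of "\<pi> y" c] step y p_less by simp
    qed
  qed
  \<comment> \<open>The preimage records the values of \<open>v\<close> at the chosen points; the
    recursion recovers the rest.\<close>
  have T_surj: "v \<in> T ` carrier_vec k" if v: "v \<in> fixed_space n g" for v
  proof (rule image_eqI[of _ _ "vec k (\<lambda>i. v $ x i)"])
    have vn: "v \<in> carrier_vec n" and rec: "\<And>j. j < n \<Longrightarrow> v $ \<pi> j = a j * v $ j"
      using v unfolding fixed_space_iff[OF g] by (auto simp: \<pi>_def a_def)
    have rec': "v $ \<pi> y = a y * v $ y" if "y \<in> orbit \<pi> z" "z < n" for y z
      using permutes_orbit_subset[OF p, of z] that rec by auto
    show "v = T (vec k (\<lambda>i. v $ x i))"
    proof (rule eq_vecI)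
      fix y assume "y < dim_vec (T (vec k (\<lambda>i. v $ x i)))"
      then have y: "y < n" by (simp add: T_def)
      show "v $ y = T (vec k (\<lambda>i. v $ x i)) $ y"
      proof (cases "\<exists>i<k. y \<in> cyc i")
        case True
        then obtain i where i: "i < k" "y \<in> cyc i" by auto
        have "v $ y = f i y * v $ x i"
          using i x[OF i(1)] by (intro cocycle_unique[OF p, where f="f i" and x="x i" and a=a and v="\<lambda>y. v $ y"] f rec') auto
        then show ?thesis using T_at[OF i(1) y i(2)] i by simp
      next
        case False
        have "(\<Prod>j\<in>orbit \<pi> y. a j) \<noteq> 1"
        proof
          assume "(\<Prod>j\<in>orbit \<pi> y. a j) = 1"
          then have "orbit \<pi> y \<in> G" using y by (simp add: G_def cycle_sets_def)
          then obtain i where "i < k" "orbit \<pi> y = cyc i" using cyc by (auto simp: bij_betw_def)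
          then show False using False self_in_orbit[OF p] by metis
        qed
        then have "v $ y = 0" using cocycle_zero[OF p, where x=y and a=a and v="\<lambda>y. v $ y"] rec' y by auto
        then show ?thesis using T_out[OF y] False by simp
      qed
    qed (use vn in \<open>simp add: T_def\<close>)
  qed simp
  have T_inj: "inj_on T (carrier_vec k)"
  proof (rule inj_onI, rule eq_vecI)
    fix c c' :: "complex vec" and i
    assume c: "c \<in> carrier_vec k" "c' \<in> carrier_vec k" "T c = T c'"
    then show "dim_vec c = dim_vec c'" by simp
    assume "i < dim_vec c'"
    then have i: "i < k" using c by simp
    have "x i \<in> cyc i" using x[OF i] self_in_orbit[OF p] by simp
    then show "c $ i = c' $ i"
      using T_at[OF i, of "x i" c] T_at[OF i, of "x i" c'] x[OF i] f(1)[OF i] c(3) by simp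
  qed
  let ?V = "module_vec TYPE(complex) k"
    and ?W = "(module_vec TYPE(complex) n)\<lparr>carrier := fixed_space n g\<rparr>"
  interpret V: vec_space "TYPE(complex)" k .
  interpret W: vectorspace class_ring ?W
    by (rule vectorspace_fixed_space[OF grn_carrier[OF g]])
  have T_dim: "dim_vec (T c) = n" for c by (simp add: T_def)
  have "T (c + c') = T c + T c'" if c: "c \<in> carrier_vec k" "c' \<in> carrier_vec k" for c c'
  proof (rule eq_vecI)
    fix y assume "y < dim_vec (T c + T c')"
    then have y: "y < n" by (simp add: T_dim)
    have "T (c + c') $ y = (\<Sum>i<k. (if y \<in> cyc i then c $ i * f i y else 0)
        + (if y \<in> cyc i then c' $ i * f i y else 0))"
      unfolding T_def index_vec[OF y] using c by (intro sum.cong refl) (simp add: distrib_right)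
    then show "T (c + c') $ y = (T c + T c') $ y"
      using y by (simp only: sum.distrib) (simp add: T_def)
  qed (simp add: T_dim)
  moreover have "T (b \<cdot>\<^sub>v c) = b \<cdot>\<^sub>v T c" if c: "c \<in> carrier_vec k" for b c
  proof (rule eq_vecI)
    fix y assume "y < dim_vec (b \<cdot>\<^sub>v T c)"
    then have y: "y < n" by (simp add: T_dim)
    have "T (b \<cdot>\<^sub>v c) $ y = (\<Sum>i<k. b * (if y \<in> cyc i then c $ i * f i y else 0))"
      unfolding T_def index_vec[OF y] using c by (intro sum.cong refl) simp
    then show "T (b \<cdot>\<^sub>v c) $ y = (b \<cdot>\<^sub>v T c) $ y"
      using y by (simp only: sum_distrib_left[symmetric]) (simp add: T_def)
  qed (simp add: T_dim)
  ultimately have "T \<in> LinearCombinations.module_hom class_ring ?V ?W"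
    unfolding LinearCombinations.module_hom_def using T_fixed by (simp add: module_vec_simps)
  then have "linear_map class_ring ?V ?W T"
    by (intro linear_map.intro mod_hom.intro mod_hom_axioms.intro vec_vs W.vectorspace_axioms
        vec_module W.module_axioms)
  then have "vectorspace.dim class_ring ?V = vectorspace.dim class_ring ?W"
    using T_inj T_surj T_fixed
    by (intro linear_map.dim_eq) (auto simp: module_vec_simps)
  then have "fixed_dim n g = k"
    unfolding fixed_dim_def using V.dim_is_n by simp
  then show ?thesis
    by (simp add: k_def G_def \<pi>_def a_def cycle_product_def)
qed

lemma one_in_grn: "1\<^sub>m n \<in> grn r n"
proof -
  have "(\<exists>!j. j < n \<and> (1\<^sub>m n :: complex mat) $$ (i, j) \<noteq> 0)"
    "(\<exists>!j. j < n \<and> (1\<^sub>m n :: complex mat) $$ (j, i) \<noteq> 0)" if "i < n" for i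
    using that by (auto intro!: ex1I[of _ i] split: if_splits)
  then show ?thesis by (auto simp: grn_def)
qed

lemma finite_grn:
  assumes "r \<ge> 1"
  shows "finite (grn r n)"
proof -
  let ?I = "{..<n} \<times> {..<n}" and ?R = "insert 0 (roots_of_unity r)"
  have "finite (roots_of_unity r)"
    unfolding roots_of_unity_def using assms by (intro finite_roots_unity)
  then have "finite (mat n n ` (?I \<rightarrow>\<^sub>E ?R))"
    by (intro finite_imageI finite_PiE) auto
  moreover have "grn r n \<subseteq> mat n n ` (?I \<rightarrow>\<^sub>E ?R)"
  proof
    fix A assume A: "A \<in> grn r n"
    show "A \<in> mat n n ` (?I \<rightarrow>\<^sub>E ?R)"
    proof (rule image_eqI)
      show "A = mat n n (restrict (\<lambda>ij. A $$ ij) ?I)"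
        using grn_carrier[OF A] by (intro eq_matI) auto
      show "restrict (\<lambda>ij. A $$ ij) ?I \<in> ?I \<rightarrow>\<^sub>E ?R"
        using A by (auto simp: grn_def roots_of_unity_def)
    qed
  qed
  ultimately show ?thesis by (rule rev_finite_subset)
qed

lemma fixed_dim_one: "fixed_dim n (1\<^sub>m n) = n"
proof -
  interpret V: vec_space "TYPE(complex)" n .
  have "fixed_space n (1\<^sub>m n) = carrier_vec n" by (auto simp: fixed_space_def)
  then have "(module_vec TYPE(complex) n)\<lparr>carrier := fixed_space n (1\<^sub>m n)\<rparr> = module_vec TYPE(complex) n"
    by (simp add: module_vec_def)
  then show ?thesis unfolding fixed_dim_def using V.dim_is_n by simp
qed

text \<open>Full dimension requires \<open>n\<close> cycles on \<open>n\<close> points, hence only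
  fixed points, and product 1 for each of them, hence diagonal entries 1. This isolates the leading
  coefficient of the Poincare sum.\<close>

lemma fixed_dim_eq_n_iff:
  assumes g: "g \<in> grn r n"
  shows "fixed_dim n g = n \<longleftrightarrow> g = 1\<^sub>m n"
proof
  assume *: "fixed_dim n g = n"
  define \<pi> where "\<pi> = perm_of n g"
  have p: "\<pi> permutes {..<n}" unfolding \<pi>_def by (rule perm_of_permutes[OF g])
  let ?S = "cycle_sets n \<pi>" and ?S1 = "{C \<in> cycle_sets n \<pi>. cycle_product n g C = 1}"
  have fin: "finite ?S" by (simp add: cycle_sets_def)
  have n1: "card ?S1 = n" using * fixed_dim_eq[OF g] by (simp add: \<pi>_def)
  have "card ?S1 \<le> card ?S" by (intro card_mono fin) auto
  moreover have "card ?S \<le> n"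
    unfolding cycle_sets_def using card_image_le[of "{..<n}" "orbit \<pi>"] by simp
  ultimately have cS: "card ?S = n" using n1 by simp
  then have "?S1 = ?S" using n1 by (intro card_subset_eq fin) auto
  then have prod1: "cycle_product n g C = 1" if "C \<in> ?S" for C using that by blast
  have inj: "inj_on (orbit \<pi>) {..<n}"
    using cS by (intro eq_card_imp_inj_on) (auto simp: cycle_sets_def)
  have fixp: "\<pi> y = y" if "y < n" for y
  proof -
    have "orbit \<pi> (\<pi> y) = orbit \<pi> y" by (rule orbit_eq[OF p]) (rule orbit.base)
    then show ?thesis
      using inj_onD[OF inj, of "\<pi> y" y] permutes_in_image[OF p, of y] that by simp
  qed
  have diag: "g $$ (y, y) = 1" if "y < n" for y
  proof -
    have "orbit \<pi> y \<in> ?S" using that by (simp add: cycle_sets_def)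
    then have "cycle_product n g {y} = 1" using prod1 orbit_fixpoint[of \<pi> y] fixp[OF that] by metis
    then show ?thesis using fixp[OF that] by (simp add: cycle_product_def \<pi>_def)
  qed
  show "g = 1\<^sub>m n"
  proof (rule eq_matI)
    fix i j assume "i < dim_row (1\<^sub>m n :: complex mat)" "j < dim_col (1\<^sub>m n :: complex mat)"
    then have ij: "i < n" "j < n" by auto
    show "g $$ (i, j) = 1\<^sub>m n $$ (i, j)"
    proof (cases "i = j")
      case True
      then show ?thesis using diag ij by simp
    next
      case False
      then have "g $$ (i, j) = 0"
        using perm_of_nonzero(3)[OF g ij(2) ij(1)] fixp[OF ij(2)] by (auto simp: \<pi>_def)
      then show ?thesis using False ij by simp
    qed
  qed (use grn_carrier[OF g] in auto)
qed (simp add: fixed_dim_one)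

section \<open>The factorization\<close>

lemma irreducible_character_one_nonzero:
  assumes "irreducible_character n (grn r n) \<chi>"
  shows "\<chi> (1\<^sub>m n) \<noteq> 0"
proof -
  obtain d \<rho> where "irreducible_representation n (grn r n) d \<rho>"
    and \<chi>: "\<forall>g\<in>grn r n. \<chi> g = (\<Sum>i<d. \<rho> g $$ (i, i))"
    using assms unfolding irreducible_character_def by auto
  then have "d > 0" "\<rho> (1\<^sub>m n) = 1\<^sub>m d" by (auto simp: irreducible_representation_def)
  then show ?thesis using \<chi>[rule_format, OF one_in_grn] by simp
qed

text \<open>The monic form of one factor of the claimed product; \<open>a\<close> is
  \<open>r - 1\<close> for the first partition and \<open>-1\<close> for the others.\<close>

definition content_poly :: "complex \<Rightarrow> nat \<Rightarrow> nat list \<Rightarrow> complex poly" where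
  "content_poly a r \<mu> = (\<Prod>b\<in>diagram \<mu>. [:a + of_nat r * of_int (box_content b), 1:])"

lemma degree_content_poly: "degree (content_poly a r \<mu>) = sum_list \<mu>"
  unfolding content_poly_def by (simp add: degree_prod_eq_sum_degree card_diagram)

lemma lead_coeff_content_poly: "lead_coeff (content_poly a r \<mu>) = 1"
  unfolding content_poly_def lead_coeff_prod by simp

text \<open>Clearing the denominator \<open>r\<close> in each box turns the content \<open>c\<close>
  into \<open>r * c\<close> and leaves one power of \<open>r\<close> per box.\<close>

lemma poly_content_poly:
  assumes "r \<ge> 1"
  shows "(\<Prod>b\<in>diagram \<mu>. (t + a) / of_nat r + of_int (box_content b))
    = poly (content_poly a r \<mu>) t / of_nat r ^ sum_list \<mu>"
proof -
  have "(\<Prod>b\<in>diagram \<mu>. (t + a) / of_nat r + of_int (box_content b))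
    = (\<Prod>b\<in>diagram \<mu>. (a + of_nat r * of_int (box_content b) + t) / of_nat r)"
    using assms by (intro prod.cong refl) (simp add: field_simps)
  then show ?thesis
    by (simp add: content_poly_def poly_prod prod_dividef card_diagram)
qed

theorem theorem6p3:
  fixes r n :: nat and lam :: "nat list list" and \<chi> :: "complex mat \<Rightarrow> complex"
  assumes "r \<ge> 1" and "n \<ge> 1"
    and "length lam = r"
    and "\<And>k. k < r \<Longrightarrow> is_partition (lam ! k)"
    and "(\<Sum>k<r. sum_list (lam ! k)) = n"
    and "is_indexed_character r n lam \<chi>"
  shows "poincare_poly r n \<chi> =
    (\<Prod>b\<in>diagram (lam ! 0). [: of_int (int r - 1 + int r * box_content b), 1 :]) *
    (\<Prod>k=1..<r. \<Prod>b\<in>diagram (lam ! k). [: of_int (- 1 + int r * box_content b), 1 :])"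
proof -
  define a :: "nat \<Rightarrow> complex" where "a k = - 1 + (if k = 0 then of_nat r else 0)" for k
  define Q where "Q = (\<Prod>k<r. content_poly (a k) r (lam ! k))"
  define S where "S = (\<Sum>w\<in>grn r n. Polynomial.monom (\<chi> w) (fixed_dim n w))"
  have irr: "irreducible_character n (grn r n) \<chi>"
    and idx: "(\<Prod>k<r. schur r k (lam ! k)) = pconst (1 / of_nat (card (grn r n))) *
         (\<Sum>g\<in>grn r n. pconst (\<chi> g) * cycle_type_monomial n g)"
    using assms(6) by (auto simp: is_indexed_character_def)
  have fin: "finite (grn r n)" by (rule finite_grn[OF assms(1)])
  then have card: "card (grn r n) \<noteq> 0" using one_in_grn by auto
  have "\<exists>K. \<forall>x. (\<Sum>\<sigma>\<in>symgrp (sum_list (lam ! k)). sym_char (lam ! k) \<sigma> *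
      x ^ num_cycles (sum_list (lam ! k)) \<sigma>)
    = K * (\<Prod>b\<in>diagram (lam ! k). x + of_int (box_content b))" if "k < r" for k
    using sum_sym_char_num_cycles[OF assms(4)[OF that]] by metis
  then obtain K where K: "\<And>k x. k < r \<Longrightarrow> (\<Sum>\<sigma>\<in>symgrp (sum_list (lam ! k)).
      sym_char (lam ! k) \<sigma> * x ^ num_cycles (sum_list (lam ! k)) \<sigma>)
    = K k * (\<Prod>b\<in>diagram (lam ! k). x + of_int (box_content b))"
    by metis
  \<comment> \<open>Collects every factor that does not depend on \<open>t\<close>; its value is
    found afterwards from the coefficient in degree \<open>n\<close>.\<close>
  define \<kappa> where "\<kappa> = of_nat (card (grn r n)) *
    (\<Prod>k<r. K k / (fact (sum_list (lam ! k)) * of_nat r ^ sum_list (lam ! k)))"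
  \<comment> \<open>The specialization inserts a complex number for \<open>t\<close>. Agreement at
    all numbers gives the equality of polynomials.\<close>
  have "poly S t = poly (Polynomial.smult \<kappa> Q) t" for t
  proof -
    let ?v = "fixed_point_spec t"
    have "poly S t = (\<Sum>g\<in>grn r n. \<chi> g * t ^ fixed_dim n g)"
      by (simp add: S_def poly_sum poly_monom)
    also have "\<dots> = of_nat (card (grn r n)) * poly_eval ?v (\<Prod>k<r. schur r k (lam ! k))"
      using card unfolding idx
      by (simp add: poly_eval_mult poly_eval_sum poly_eval_pconst poly_eval_cycle_type_monomial
          fixed_dim_eq)
    also have "poly_eval ?v (\<Prod>k<r. schur r k (lam ! k))
      = (\<Prod>k<r. K k / (fact (sum_list (lam ! k)) * of_nat r ^ sum_list (lam ! k))
          * poly (content_poly (a k) r (lam ! k)) t)"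
      unfolding poly_eval_prod
    proof (intro prod.cong refl)
      fix k assume "k \<in> {..<r}"
      then have k: "k < r" by simp
      have "(t - 1 + (if k = 0 then of_nat r else 0)) / of_nat r = (t + a k) / of_nat r"
        by (simp add: a_def)
      then show "poly_eval ?v (schur r k (lam ! k))
        = K k / (fact (sum_list (lam ! k)) * of_nat r ^ sum_list (lam ! k))
          * poly (content_poly (a k) r (lam ! k)) t"
        unfolding poly_eval_schur[OF k] by (simp only: K[OF k] poly_content_poly[OF assms(1)]) simp
    qed
    finally show ?thesis
      by (simp only: \<kappa>_def Q_def poly_smult poly_prod prod.distrib mult.assoc)
  qed
  then have SQ: "S = Polynomial.smult \<kappa> Q"
    using poly_eq_poly_eq_iff by blast
  have "content_poly (a k) r \<mu> \<noteq> 0" for k \<mu>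
    using lead_coeff_content_poly[of "a k" r \<mu>] by auto
  then have "degree Q = n"
    unfolding Q_def using assms(5) by (simp add: degree_prod_eq_sum_degree degree_content_poly)
  moreover have "lead_coeff Q = 1"
    unfolding Q_def lead_coeff_prod by (simp add: lead_coeff_content_poly)
  ultimately have "coeff S n = \<kappa>" using SQ by simp
  moreover have "coeff S n = \<chi> (1\<^sub>m n)"
  proof -
    have "coeff S n = (\<Sum>w\<in>grn r n. if w = 1\<^sub>m n then \<chi> w else 0)"
      unfolding S_def coeff_sum by (intro sum.cong refl) (simp add: fixed_dim_eq_n_iff)
    then show ?thesis using fin one_in_grn by simp
  qed
  ultimately have "\<kappa> = \<chi> (1\<^sub>m n)" by simp
  then have "poincare_poly r n \<chi> = Q"
    using irreducible_character_one_nonzero[OF irr] SQ by (simp add: poincare_poly_def S_def)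
  also have "Q = content_poly (a 0) r (lam ! 0) * (\<Prod>k=1..<r. content_poly (a k) r (lam ! k))"
    unfolding Q_def lessThan_atLeast0 using assms(1) by (simp add: prod.atLeast_Suc_lessThan)
  also have "content_poly (a 0) r (lam ! 0)
    = (\<Prod>b\<in>diagram (lam ! 0). [: of_int (int r - 1 + int r * box_content b), 1 :])"
    by (simp add: content_poly_def a_def)
  also have "(\<Prod>k=1..<r. content_poly (a k) r (lam ! k))
    = (\<Prod>k=1..<r. \<Prod>b\<in>diagram (lam ! k). [: of_int (- 1 + int r * box_content b), 1 :])"
    by (intro prod.cong refl) (simp add: content_poly_def a_def)
  finally show ?thesis .
qed

end
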